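(* The problem $\chi$-$\textsc{Stability}$ is in $\mathrm{P}$ for all co-graphs; that is, there is a deterministic polynomial-time algorithm that, given any co-graph $G$, decides whether $G$ is $\chi$-stable.
   Context: Graphs are finite, undirected, simple, without loops. Co-graphs are defined recursively: a single-vertex graph $(\{v\},\emptyset)$ is a co-graph; if $G_1$ and $G_2$ are (vertex-disjoint) co-graphs, then so are their disjoint union $G_1\cup G_2$ and their join $G_1+G_2$ (the disjoint union together with all edges between $V(G_1)$ and $V(G_2)$). $\chi(G)$ is the chromatic number. $G$ is $\chi$-stable if $\chi(G-e)=\chi(G)$ for every edge $e\in E(G)$, where $G-e$ is $G$ with the edge $e$ deleted; $\chi$-$\textsc{Stability}$ is the set of $\chi$-stable graphs. Running time is polynomial in the size of the encoding of $G$. *)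

theory Defs
  imports "HOL-Computational_Algebra.Polynomial"
begin

section \<open>Finite simple graphs and co-graphs\<close>

type_synonym 'v graph = "'v set \<times> 'v set set"

abbreviation verts :: "'v graph \<Rightarrow> 'v set" where "verts \<equiv> fst"
abbreviation edges :: "'v graph \<Rightarrow> 'v set set" where "edges \<equiv> snd"

definition simple_graph :: "'v graph \<Rightarrow> bool" where
  "simple_graph G \<longleftrightarrow> finite (verts G) \<and> (\<forall>e\<in>edges G. e \<subseteq> verts G \<and> card e = 2)"

definition disjoint_union :: "'v graph \<Rightarrow> 'v graph \<Rightarrow> 'v graph" where
  "disjoint_union G H = (verts G \<union> verts H, edges G \<union> edges H)"

definition graph_join :: "'v graph \<Rightarrow> 'v graph \<Rightarrow> 'v graph" where
  "graph_join G H =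
     (verts G \<union> verts H, edges G \<union> edges H \<union> {{u, v} | u v. u \<in> verts G \<and> v \<in> verts H})"

inductive cograph :: "'v graph \<Rightarrow> bool" where
  single: "cograph ({v}, {})"
| union: "cograph G \<Longrightarrow> cograph H \<Longrightarrow> verts G \<inter> verts H = {} \<Longrightarrow> cograph (disjoint_union G H)"
| join: "cograph G \<Longrightarrow> cograph H \<Longrightarrow> verts G \<inter> verts H = {} \<Longrightarrow> cograph (graph_join G H)"

lemma cograph_simple_graph: "cograph G \<Longrightarrow> simple_graph G"
proof (induction rule: cograph.induct)
  case (join G H)
  then have "card {u, v} = 2" if "u \<in> verts G" "v \<in> verts H" for u v
    using that by (metis card_2_iff disjoint_iff)
  with join show ?case
    by (auto simp: simple_graph_def graph_join_def)
qed (auto simp: simple_graph_def disjoint_union_def)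

section \<open>Chromatic number and stability\<close>

definition colorable :: "nat \<Rightarrow> 'v graph \<Rightarrow> bool" where
  "colorable k G \<longleftrightarrow>
     (\<exists>c :: 'v \<Rightarrow> nat. (\<forall>v\<in>verts G. c v < k) \<and> (\<forall>u v. {u, v} \<in> edges G \<longrightarrow> c u \<noteq> c v))"

definition chromatic_number :: "'v graph \<Rightarrow> nat" where
  "chromatic_number G = (LEAST k. colorable k G)"

definition delete_edge :: "'v graph \<Rightarrow> 'v set \<Rightarrow> 'v graph" where
  "delete_edge G e = (verts G, edges G - {e})"

definition chi_stable :: "'v graph \<Rightarrow> bool" where
  "chi_stable G \<longleftrightarrow> (\<forall>e\<in>edges G. chromatic_number (delete_edge G e) = chromatic_number G)"

definition chi_Stability :: "'v graph set" where
  "chi_Stability = {G. simple_graph G \<and> chi_stable G}"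

section \<open>Deterministic multi-tape Turing machines\<close>

text \<open>
  States are the numbers below \<open>num_states\<close>, tape symbols the numbers below \<open>num_symbols\<close>, and
  computations start in state 0. Tapes are infinite to the right; cell 0 initially holds a
  start marker, and a head moving left from cell 0 stays there.
\<close>

datatype dir = Move_Left | Stay | Move_Right

record tm =
  num_tapes :: nat
  num_symbols :: nat
  num_states :: nat
  accept_state :: nat
  reject_state :: nat
  delta :: "nat \<Rightarrow> nat list \<Rightarrow> nat \<times> (nat \<times> dir) list"

abbreviation blank_sym :: nat where "blank_sym \<equiv> 0"
abbreviation start_sym :: nat where "start_sym \<equiv> 1"

definition bit_sym :: "bool \<Rightarrow> nat" where
  "bit_sym b = (if b then 3 else 2)"

definition wf_tm :: "tm \<Rightarrow> bool" where
  "wf_tm M \<longleftrightarrow>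
     num_tapes M \<ge> 1 \<and> num_symbols M \<ge> 4 \<and> num_states M \<ge> 1 \<and>
     accept_state M < num_states M \<and> reject_state M < num_states M \<and>
     accept_state M \<noteq> reject_state M \<and>
     (\<forall>q syms. q < num_states M \<and> length syms = num_tapes M \<and> set syms \<subseteq> {..<num_symbols M} \<longrightarrow>
        fst (delta M q syms) < num_states M \<and>
        length (snd (delta M q syms)) = num_tapes M \<and>
        (\<forall>(s, d) \<in> set (snd (delta M q syms)). s < num_symbols M))"

text \<open>A tape is its cell contents together with the head position.\<close>

type_synonym tape = "(nat \<Rightarrow> nat) \<times> nat"
type_synonym tm_config = "nat \<times> tape list"

definition read_tape :: "tape \<Rightarrow> nat" where
  "read_tape tp = fst tp (snd tp)"

fun move_head :: "dir \<Rightarrow> nat \<Rightarrow> nat" where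
  "move_head Move_Left i = i - 1"
| "move_head Stay i = i"
| "move_head Move_Right i = i + 1"

definition act_tape :: "nat \<times> dir \<Rightarrow> tape \<Rightarrow> tape" where
  "act_tape a tp = ((fst tp)(snd tp := fst a), move_head (snd a) (snd tp))"

definition halted :: "tm \<Rightarrow> tm_config \<Rightarrow> bool" where
  "halted M cfg \<longleftrightarrow> fst cfg \<in> {accept_state M, reject_state M}"

definition tm_step :: "tm \<Rightarrow> tm_config \<Rightarrow> tm_config" where
  "tm_step M cfg =
     (if halted M cfg then cfg
      else let (q, acts) = delta M (fst cfg) (map read_tape (snd cfg))
           in (q, map2 act_tape acts (snd cfg)))"

definition empty_tape :: tape where
  "empty_tape = ((\<lambda>i. if i = 0 then start_sym else blank_sym), 0)"

definition input_tape :: "bool list \<Rightarrow> tape" where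
  "input_tape x =
     ((\<lambda>i. if i = 0 then start_sym
           else if i \<le> length x then bit_sym (x ! (i - 1)) else blank_sym), 0)"

definition init_config :: "tm \<Rightarrow> bool list \<Rightarrow> tm_config" where
  "init_config M x = (0, input_tape x # replicate (num_tapes M - 1) empty_tape)"

definition config_after :: "tm \<Rightarrow> bool list \<Rightarrow> nat \<Rightarrow> tm_config" where
  "config_after M x t = (tm_step M ^^ t) (init_config M x)"

definition accepts :: "tm \<Rightarrow> bool list \<Rightarrow> bool" where
  "accepts M x \<longleftrightarrow> (\<exists>t. fst (config_after M x t) = accept_state M)"

definition rejects :: "tm \<Rightarrow> bool list \<Rightarrow> bool" where
  "rejects M x \<longleftrightarrow> (\<exists>t. fst (config_after M x t) = reject_state M)"

definition poly_time :: "tm \<Rightarrow> bool" where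
  "poly_time M \<longleftrightarrow> (\<exists>p :: nat poly. \<forall>x. halted M (config_after M x (poly p (length x))))"

section \<open>Graph problems in P on a class of graphs\<close>

text \<open>
  A graph is presented by the rows of its adjacency matrix, one after the other, with respect
  to an arbitrary enumeration of its vertices.
\<close>

definition adj_matrix :: "'v list \<Rightarrow> 'v graph \<Rightarrow> bool list" where
  "adj_matrix vs G = concat (map (\<lambda>u. map (\<lambda>v. {u, v} \<in> edges G) vs) vs)"

text \<open>
  The machine must run in polynomial time on every bit string, but its answer is only
  constrained on encodings of graphs in the class \<open>C\<close>. The vertex type is fixed to \<open>nat\<close> so
  that a single machine serves all graphs: a type variable would be quantified outside the
  existential quantifier over machines. Every finite graph is isomorphic to one over \<open>nat\<close>.
\<close>

definition in_P_on :: "nat graph set \<Rightarrow> nat graph set \<Rightarrow> bool" where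
  "in_P_on C L \<longleftrightarrow>
     (\<exists>M. wf_tm M \<and> poly_time M \<and>
       (\<forall>G\<in>C. \<forall>vs. distinct vs \<and> set vs = verts G \<longrightarrow>
          (G \<in> L \<longrightarrow> accepts M (adj_matrix vs G)) \<and>
          (G \<notin> L \<longrightarrow> rejects M (adj_matrix vs G))))"

end

theory Submission
  imports Defs
begin

text \<open>
  Call a vertex critical if its deletion lowers the chromatic number. In every graph both
  endpoints of an edge whose deletion lowers the chromatic number are critical. In a co-graph,
  conversely, any two critical vertices \<open>u\<close>, \<open>v\<close> span such an edge, by induction on the
  construction: in a union they lie in the same part, and across a join a
  new colour shared by \<open>u\<close> and \<open>v\<close> replaces the two colours saved by deleting them. Hence a
  co-graph is stable if and only if it has at most one critical vertex.

  To test \<open>u\<close>, colour \<open>G - u\<close> greedily, each class being a maximal independent set of the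
  vertices left. In a co-graph every clique outside a maximal independent set can be
  enlarged, so the classes are as many as the vertices of a largest clique, and the colouring is
  optimal. Then \<open>u\<close> is critical if and only if every class contains a neighbour of \<open>u\<close>: if some
  class does not, \<open>u\<close> fits into it, and otherwise \<open>{u}\<close> is one more class and the clique
  argument applies to \<open>G\<close>.

  This greedy test needs only nested loops whose number of rounds is the input length. Programs
  of this kind run in polynomial time on every input, for syntactic reasons, and translate
  into Turing machines whose states are the continuations of the program.
\<close>

section \<open>Critical vertices of co-graphs\<close>

text \<open>The machine sees an adjacency matrix only, not a decomposition of the co-graph. The
  decomposition is therefore confined to proofs, where it enters through the inductions
  \<open>edge_critical_if_critical\<close> and \<open>clique_extend\<close>; the algorithm inspects
  nothing but adjacencies. Nor does it compute or compare chromatic numbers: whether every greedy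
  class contains a neighbour of \<open>u\<close> is a single truth value, so marks on the vertices,
  two flags and a counter suffice as memory. A loop over the \<open>n\<close> vertices is given
  \<open>n * n\<close> rounds, the length of the input, because this is the only bound at hand
  before \<open>n\<close> is known; the surplus rounds have to be idle, and much of the bookkeeping
  on tapes serves to make them so.\<close>

definition colors :: "'v graph \<Rightarrow> 'v set \<Rightarrow> nat \<Rightarrow> bool" where
  "colors G X k \<longleftrightarrow>
     (\<exists>c :: 'v \<Rightarrow> nat. (\<forall>x\<in>X. c x < k) \<and> (\<forall>u\<in>X. \<forall>v\<in>X. {u, v} \<in> edges G \<longrightarrow> c u \<noteq> c v))"

definition clique :: "'v graph \<Rightarrow> 'v set \<Rightarrow> bool" where
  "clique G Q \<longleftrightarrow> (\<forall>u\<in>Q. \<forall>v\<in>Q. u \<noteq> v \<longrightarrow> {u, v} \<in> edges G)"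

text \<open>Deletion of a vertex is a smaller set \<open>X\<close> in \<open>colors\<close>, with
  the edges of \<open>G\<close> kept, so no induced subgraph has to be formed. Since
  \<open>colors\<close> is monotone in the number of colours, a single separating \<open>k\<close>
  expresses a drop of the chromatic number.\<close>

definition critical :: "'v graph \<Rightarrow> 'v \<Rightarrow> bool" where
  "critical G u \<longleftrightarrow> (\<exists>k. colors G (verts G - {u}) k \<and> \<not> colors G (verts G) k)"

definition maximal_indep :: "'v graph \<Rightarrow> 'v set \<Rightarrow> 'v set \<Rightarrow> bool" where
  "maximal_indep G R I \<longleftrightarrow> I \<subseteq> R \<and> (\<forall>u\<in>I. \<forall>v\<in>I. {u, v} \<notin> edges G) \<and>
     (\<forall>u\<in>R - I. \<exists>v\<in>I. {u, v} \<in> edges G)"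

section \<open>Colourings of vertex sets and the chromatic number\<close>

lemma simple_edgeD:
  assumes "simple_graph G" "{u, v} \<in> edges G"
  shows "u \<in> verts G" "v \<in> verts G" "u \<noteq> v"
  using assms by (auto simp: simple_graph_def)

lemma colorsI:
  fixes c :: "'v \<Rightarrow> nat"
  assumes "\<And>x. x \<in> X \<Longrightarrow> c x < k" "\<And>u v. u \<in> X \<Longrightarrow> v \<in> X \<Longrightarrow> {u, v} \<in> edges G \<Longrightarrow> c u \<noteq> c v"
  shows "colors G X k"
  unfolding colors_def using assms by (intro exI[of _ c]) simp

lemma colorsE:
  assumes "colors G X k"
  obtains c :: "'v \<Rightarrow> nat" where "\<And>x. x \<in> X \<Longrightarrow> c x < k"
    "\<And>u v. u \<in> X \<Longrightarrow> v \<in> X \<Longrightarrow> {u, v} \<in> edges G \<Longrightarrow> c u \<noteq> c v"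
  using assms unfolding colors_def by metis

lemma colorable_iff_colors:
  assumes "simple_graph G"
  shows "colorable k G \<longleftrightarrow> colors G (verts G) k"
  unfolding colorable_def colors_def using simple_edgeD(1,2)[OF assms] by blast

lemma colors_mono:
  assumes "colors G X k" "Y \<subseteq> X" "k \<le> l"
  shows "colors G Y l"
proof -
  obtain c where c: "\<And>x. x \<in> X \<Longrightarrow> c x < k"
      "\<And>u v. u \<in> X \<Longrightarrow> v \<in> X \<Longrightarrow> {u, v} \<in> edges G \<Longrightarrow> c u \<noteq> c v"
    using assms(1) by (rule colorsE) blast
  show ?thesis
  proof (rule colorsI[where c = c])
    show "c x < l" if "x \<in> Y" for x using c(1)[of x] that assms(2,3) by auto
    show "c u \<noteq> c v" if "u \<in> Y" "v \<in> Y" "{u, v} \<in> edges G" for u v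
      using c(2)[of u v] that assms(2) by blast
  qed
qed

text \<open>The colours may be arbitrary numbers as long as few of them occur, since a bijection
  onto an initial segment renumbers them. This allows a colouring of a join to be restricted to one
  side and its palette to be counted there.\<close>

lemma colorsI_card:
  fixes c :: "'v \<Rightarrow> nat"
  assumes "finite X" "card (c ` X) \<le> k" "\<And>u v. u \<in> X \<Longrightarrow> v \<in> X \<Longrightarrow> {u, v} \<in> edges G \<Longrightarrow> c u \<noteq> c v"
  shows "colors G X k"
proof -
  obtain h where h: "inj_on h (c ` X)" "h ` (c ` X) = {0..<card (c ` X)}"
    using ex_bij_betw_finite_nat[of "c ` X"] assms(1) by (auto simp: bij_betw_def)
  show ?thesis
  proof (rule colorsI[where c = "h \<circ> c"])
    show "(h \<circ> c) x < k" if "x \<in> X" for x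
    proof -
      have "h (c x) \<in> h ` (c ` X)" using that by blast
      then show ?thesis using h(2) assms(2) by simp
    qed
    show "(h \<circ> c) u \<noteq> (h \<circ> c) v" if "u \<in> X" "v \<in> X" "{u, v} \<in> edges G" for u v
      using assms(3)[OF that] h(1) that by (simp add: inj_on_eq_iff)
  qed
qed

lemma colors_cong_edges:
  assumes "\<And>u v. u \<in> X \<Longrightarrow> v \<in> X \<Longrightarrow> {u, v} \<in> edges G \<longleftrightarrow> {u, v} \<in> edges H"
  shows "colors G X k \<longleftrightarrow> colors H X k"
  unfolding colors_def using assms by auto

lemma colors_antimono_edges:
  assumes "colors H X k" "edges G \<subseteq> edges H"
  shows "colors G X k"
  using assms unfolding colors_def by blast

text \<open>\<open>u\<close> receives the fresh colour \<open>k\<close>. One vertex thus accounts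
  for at most one colour, which pins the separating \<open>k\<close> of a critical vertex to a
  single value.\<close>

lemma colors_Suc_insert:
  assumes "colors G (X - {u}) k" "simple_graph G"
  shows "colors G X (Suc k)"
proof -
  obtain c where c: "\<And>x. x \<in> X - {u} \<Longrightarrow> c x < k"
      "\<And>x y. x \<in> X - {u} \<Longrightarrow> y \<in> X - {u} \<Longrightarrow> {x, y} \<in> edges G \<Longrightarrow> c x \<noteq> c y"
    using assms(1) by (rule colorsE) blast
  show ?thesis
  proof (rule colorsI[where c = "c(u := k)"])
    show "(c(u := k)) x < Suc k" if "x \<in> X" for x
      using c(1)[of x] that by (cases "x = u") auto
    show "(c(u := k)) x \<noteq> (c(u := k)) y" if "x \<in> X" "y \<in> X" "{x, y} \<in> edges G" for x y
      using c(2)[of x y] c(1)[of x] c(1)[of y] simple_edgeD(3)[OF assms(2) that(3)] that by auto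
  qed
qed

lemma clique_card_le_colors:
  assumes "clique G Q" "Q \<subseteq> X" "colors G X k"
  shows "card Q \<le> k"
proof -
  obtain c where c: "\<And>x. x \<in> X \<Longrightarrow> c x < k"
      "\<And>u v. u \<in> X \<Longrightarrow> v \<in> X \<Longrightarrow> {u, v} \<in> edges G \<Longrightarrow> c u \<noteq> c v"
    using assms(3) by (rule colorsE) blast
  have "inj_on c Q"
  proof (rule inj_onI, rule ccontr)
    fix x y assume "x \<in> Q" "y \<in> Q" "c x = c y" "x \<noteq> y"
    then show False using assms(1,2) c(2)[of x y] unfolding clique_def by blast
  qed
  moreover have "c ` Q \<subseteq> {..<k}" using c(1) assms(2) by auto
  ultimately have "card Q \<le> card {..<k}" by (meson card_inj_on_le finite_lessThan)
  then show ?thesis by simp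
qed

lemma ex_colors:
  assumes "simple_graph G"
  shows "\<exists>k. colors G (verts G) k"
proof -
  have "finite (verts G)" using assms by (simp add: simple_graph_def)
  then obtain h :: "_ \<Rightarrow> nat" where "inj_on h (verts G)"
    using finite_imp_inj_to_nat_seg by blast
  then have "colors G (verts G) (card (h ` verts G))"
    using \<open>finite (verts G)\<close> simple_edgeD(3)[OF assms]
    by (intro colorsI_card[where c = h]) (auto simp: inj_on_eq_iff)
  then show ?thesis by blast
qed

text \<open>With this equivalence for every \<open>k\<close>, chromatic numbers are handled through
  their upper bounds; the least number itself is unfolded only here.\<close>

lemma chromatic_number_le_iff:
  assumes "simple_graph G"
  shows "chromatic_number G \<le> k \<longleftrightarrow> colors G (verts G) k"
proof
  assume "chromatic_number G \<le> k"
  moreover have "colors G (verts G) (chromatic_number G)"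
    using ex_colors[OF assms] LeastI_ex[of "\<lambda>k. colorable k G"]
    by (simp add: chromatic_number_def colorable_iff_colors[OF assms])
  ultimately show "colors G (verts G) k" using colors_mono by blast
next
  assume "colors G (verts G) k"
  then show "chromatic_number G \<le> k"
    unfolding chromatic_number_def by (intro Least_le) (simp add: colorable_iff_colors[OF assms])
qed

lemma simple_delete_edge: "simple_graph G \<Longrightarrow> simple_graph (delete_edge G e)"
  unfolding simple_graph_def delete_edge_def by simp

text \<open>Deleting an edge never raises the chromatic number, so a difference is a drop, and some
  \<open>k\<close> separates the two values.\<close>

lemma not_chi_stable_iff:
  assumes "simple_graph G"
  shows "\<not> chi_stable G \<longleftrightarrow>
    (\<exists>e\<in>edges G. \<exists>k. colors (delete_edge G e) (verts G) k \<and> \<not> colors G (verts G) k)"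
proof -
  have "chromatic_number (delete_edge G e) \<noteq> chromatic_number G \<longleftrightarrow>
      (\<exists>k. colors (delete_edge G e) (verts G) k \<and> \<not> colors G (verts G) k)" for e
  proof -
    have *: "chromatic_number (delete_edge G e) \<le> k \<longleftrightarrow> colors (delete_edge G e) (verts G) k" for k
      using chromatic_number_le_iff[OF simple_delete_edge[OF assms]] by (simp add: delete_edge_def)
    have "colors (delete_edge G e) (verts G) k" if "colors G (verts G) k" for k
      using colors_antimono_edges[OF that] by (simp add: delete_edge_def)
    then have "chromatic_number (delete_edge G e) \<le> chromatic_number G"
      using chromatic_number_le_iff[OF assms, of "chromatic_number G"] * by blast
    then have "chromatic_number (delete_edge G e) \<noteq> chromatic_number G \<longleftrightarrow>
        (\<exists>k. chromatic_number (delete_edge G e) \<le> k \<and> \<not> chromatic_number G \<le> k)"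
      by auto
    then show ?thesis unfolding chromatic_number_le_iff[OF assms] * .
  qed
  then show ?thesis unfolding chi_stable_def by blast
qed

text \<open>The edge has \<open>u\<close> as an endpoint, so among the vertices other than
  \<open>u\<close> it makes no difference whether it is present.\<close>

lemma critical_if_edge_critical:
  assumes "simple_graph G" "colors (delete_edge G {u, v}) (verts G) k" "\<not> colors G (verts G) k"
  shows "colors G (verts G - {u}) k"
proof -
  have "colors (delete_edge G {u, v}) (verts G - {u}) k"
    using colors_mono[OF assms(2)] by blast
  moreover have "colors G (verts G - {u}) k = colors (delete_edge G {u, v}) (verts G - {u}) k"
    by (rule colors_cong_edges) (simp add: delete_edge_def doubleton_eq_iff)
  ultimately show ?thesis by simp
qed

section \<open>Edges and colourings of unions and joins\<close>

lemma edges_union_join: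
  assumes "simple_graph G" "simple_graph H" "verts G \<inter> verts H = {}"
  shows
    "u \<in> verts G \<Longrightarrow> v \<in> verts G \<Longrightarrow> {u, v} \<in> edges (disjoint_union G H) \<longleftrightarrow> {u, v} \<in> edges G"
    "u \<in> verts H \<Longrightarrow> v \<in> verts H \<Longrightarrow> {u, v} \<in> edges (disjoint_union G H) \<longleftrightarrow> {u, v} \<in> edges H"
    "u \<in> verts G \<Longrightarrow> v \<in> verts H \<Longrightarrow> {u, v} \<notin> edges (disjoint_union G H)"
    "u \<in> verts G \<Longrightarrow> v \<in> verts G \<Longrightarrow> {u, v} \<in> edges (graph_join G H) \<longleftrightarrow> {u, v} \<in> edges G"
    "u \<in> verts H \<Longrightarrow> v \<in> verts H \<Longrightarrow> {u, v} \<in> edges (graph_join G H) \<longleftrightarrow> {u, v} \<in> edges H"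
    "u \<in> verts G \<Longrightarrow> v \<in> verts H \<Longrightarrow> {u, v} \<in> edges (graph_join G H)"
proof -
  have G: "x \<in> verts G" "y \<in> verts G" "x \<notin> verts H" "y \<notin> verts H" if "{x, y} \<in> edges G" for x y
    using simple_edgeD(1,2)[OF assms(1) that] assms(3) by blast+
  have H: "x \<in> verts H" "y \<in> verts H" "x \<notin> verts G" "y \<notin> verts G" if "{x, y} \<in> edges H" for x y
    using simple_edgeD(1,2)[OF assms(2) that] assms(3) by blast+
  have J: "{x, y} \<in> {{x, y} |x y. x \<in> verts G \<and> y \<in> verts H} \<longleftrightarrow>
      x \<in> verts G \<and> y \<in> verts H \<or> y \<in> verts G \<and> x \<in> verts H" for x y
    by (auto simp: doubleton_eq_iff)
  note D = disjoint_union_def graph_join_def snd_conv Un_iff J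
  show "{u, v} \<in> edges (disjoint_union G H) \<longleftrightarrow> {u, v} \<in> edges G" if "u \<in> verts G" "v \<in> verts G"
    unfolding D using H(3)[of u v] that by blast
  show "{u, v} \<in> edges (disjoint_union G H) \<longleftrightarrow> {u, v} \<in> edges H" if "u \<in> verts H" "v \<in> verts H"
    unfolding D using G(3)[of u v] that by blast
  show "{u, v} \<notin> edges (disjoint_union G H)" if "u \<in> verts G" "v \<in> verts H"
    unfolding D using G(4)[of u v] H(3)[of u v] that by blast
  show "{u, v} \<in> edges (graph_join G H) \<longleftrightarrow> {u, v} \<in> edges G" if "u \<in> verts G" "v \<in> verts G"
    unfolding D using H(3)[of u v] that assms(3) by blast
  show "{u, v} \<in> edges (graph_join G H) \<longleftrightarrow> {u, v} \<in> edges H" if "u \<in> verts H" "v \<in> verts H"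
    unfolding D using G(3)[of u v] that assms(3) by blast
  show "{u, v} \<in> edges (graph_join G H)" if "u \<in> verts G" "v \<in> verts H"
    unfolding D using that by blast
qed

lemma disjoint_union_commute: "disjoint_union G H = disjoint_union H G"
  by (auto simp: disjoint_union_def)

lemma graph_join_commute: "graph_join G H = graph_join H G"
  unfolding graph_join_def by (auto simp: insert_commute)

lemma colors_disjoint_union:
  assumes "simple_graph G" "simple_graph H" "verts G \<inter> verts H = {}" "X \<subseteq> verts G" "Y \<subseteq> verts H"
    "colors G X k" "colors H Y k"
  shows "colors (disjoint_union G H) (X \<union> Y) k"
proof -
  obtain c where c: "\<And>x. x \<in> X \<Longrightarrow> c x < k"
      "\<And>u v. u \<in> X \<Longrightarrow> v \<in> X \<Longrightarrow> {u, v} \<in> edges G \<Longrightarrow> c u \<noteq> c v"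
    using assms(6) by (rule colorsE) blast
  obtain d where d: "\<And>x. x \<in> Y \<Longrightarrow> d x < k"
      "\<And>u v. u \<in> Y \<Longrightarrow> v \<in> Y \<Longrightarrow> {u, v} \<in> edges H \<Longrightarrow> d u \<noteq> d v"
    using assms(7) by (rule colorsE) blast
  note E = edges_union_join[OF assms(1-3)]
  show ?thesis
  proof (rule colorsI[where c = "\<lambda>x. if x \<in> X then c x else d x"])
    show "(if x \<in> X then c x else d x) < k" if "x \<in> X \<union> Y" for x
      using c(1) d(1) that by auto
  next
    fix u v assume uv: "u \<in> X \<union> Y" "v \<in> X \<union> Y" "{u, v} \<in> edges (disjoint_union G H)"
    consider "u \<in> X" "v \<in> X" | "u \<in> X" "v \<in> Y" | "u \<in> Y" "v \<in> X" | "u \<in> Y" "v \<in> Y" using uv by blast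
    then show "(if u \<in> X then c u else d u) \<noteq> (if v \<in> X then c v else d v)"
    proof cases
      case 1 then show ?thesis using E(1)[of u v] uv(3) c(2)[of u v] assms(4) by auto
    next
      case 2 then show ?thesis using E(3)[of u v] uv(3) assms(4,5) by auto
    next
      case 3 then show ?thesis using E(3)[of v u] uv(3) assms(4,5) by (auto simp: insert_commute)
    next
      case 4 then have "u \<notin> X" "v \<notin> X" using assms(3-5) by auto
      with 4 show ?thesis using E(2)[of u v] uv(3) d(2)[of u v] assms(5) by auto
    qed
  qed
qed

text \<open>No colour can occur on both sides of a join, so a colouring splits into two with
  disjoint palettes. Conversely, the palette of \<open>H\<close> is shifted by
  \<open>a\<close>.\<close>

lemma colors_join:
  assumes "simple_graph G" "simple_graph H" "verts G \<inter> verts H = {}" "X \<subseteq> verts G" "Y \<subseteq> verts H"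
  shows "colors (graph_join G H) (X \<union> Y) k \<longleftrightarrow> (\<exists>a b. a + b \<le> k \<and> colors G X a \<and> colors H Y b)"
proof
  note E = edges_union_join[OF assms(1-3)]
  assume "colors (graph_join G H) (X \<union> Y) k"
  then obtain c where c: "\<And>x. x \<in> X \<union> Y \<Longrightarrow> c x < k"
      "\<And>u v. u \<in> X \<union> Y \<Longrightarrow> v \<in> X \<union> Y \<Longrightarrow> {u, v} \<in> edges (graph_join G H) \<Longrightarrow> c u \<noteq> c v"
    by (rule colorsE) blast
  have fin: "finite X" "finite Y"
    using assms unfolding simple_graph_def by (meson finite_subset)+
  have "colors G X (card (c ` X))"
    by (rule colorsI_card[OF fin(1) order.refl]) (use c(2) E(4) assms(4) in blast)
  moreover have "colors H Y (card (c ` Y))"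
    by (rule colorsI_card[OF fin(2) order.refl]) (use c(2) E(5) assms(5) in blast)
  moreover have "c ` X \<inter> c ` Y = {}"
  proof -
    have "c x \<noteq> c y" if "x \<in> X" "y \<in> Y" for x y
      using c(2)[of x y] E(6)[of x y] that assms(4,5) by blast
    then show ?thesis by auto
  qed
  then have "card (c ` X) + card (c ` Y) = card (c ` (X \<union> Y))"
    using fin by (simp add: image_Un card_Un_disjoint)
  moreover have "c ` (X \<union> Y) \<subseteq> {..<k}" using c(1) by auto
  then have "card (c ` (X \<union> Y)) \<le> k" using card_mono[of "{..<k}"] by fastforce
  ultimately show "\<exists>a b. a + b \<le> k \<and> colors G X a \<and> colors H Y b" by metis
next
  note E = edges_union_join[OF assms(1-3)]
  assume "\<exists>a b. a + b \<le> k \<and> colors G X a \<and> colors H Y b"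
  then obtain a b where ab: "a + b \<le> k" "colors G X a" "colors H Y b" by blast
  obtain c where c: "\<And>x. x \<in> X \<Longrightarrow> c x < a"
      "\<And>u v. u \<in> X \<Longrightarrow> v \<in> X \<Longrightarrow> {u, v} \<in> edges G \<Longrightarrow> c u \<noteq> c v"
    using ab(2) by (rule colorsE) blast
  obtain d where d: "\<And>x. x \<in> Y \<Longrightarrow> d x < b"
      "\<And>u v. u \<in> Y \<Longrightarrow> v \<in> Y \<Longrightarrow> {u, v} \<in> edges H \<Longrightarrow> d u \<noteq> d v"
    using ab(3) by (rule colorsE) blast
  show "colors (graph_join G H) (X \<union> Y) k"
  proof (rule colorsI[where c = "\<lambda>x. if x \<in> X then c x else a + d x"])
    show "(if x \<in> X then c x else a + d x) < k" if "x \<in> X \<union> Y" for x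
      using c(1)[of x] d(1)[of x] that ab(1) by auto
  next
    fix u v assume uv: "u \<in> X \<union> Y" "v \<in> X \<union> Y" "{u, v} \<in> edges (graph_join G H)"
    consider "u \<in> X" "v \<in> X" | "u \<in> X" "v \<in> Y" | "u \<in> Y" "v \<in> X" | "u \<in> Y" "v \<in> Y" using uv by blast
    then show "(if u \<in> X then c u else a + d u) \<noteq> (if v \<in> X then c v else a + d v)"
    proof cases
      case 1 then show ?thesis using E(4)[of u v] uv(3) c(2)[of u v] assms(4) by auto
    next
      case 2 then have "v \<notin> X" using assms(3-5) by auto
      with 2 show ?thesis using c(1)[of u] by simp
    next
      case 3 then have "u \<notin> X" using assms(3-5) by auto
      with 3 show ?thesis using c(1)[of v] by simp
    next
      case 4 then have "u \<notin> X" "v \<notin> X" using assms(3-5) by auto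
      with 4 show ?thesis using E(5)[of u v] uv(3) d(2)[of u v] assms(5) by auto
    qed
  qed
qed

text \<open>Without the edge, \<open>u\<close> and \<open>v\<close> are not adjacent, and one new
  colour \<open>a + b\<close> serves both, on top of a colouring of the other vertices by
  \<open>a + b\<close> colours.\<close>

lemma colors_delete_edge_join:
  assumes s: "simple_graph G" "simple_graph H" and dj: "verts G \<inter> verts H = {}"
    and uv: "u \<in> verts G" "v \<in> verts H"
    and a: "colors G (verts G - {u}) a" and b: "colors H (verts H - {v}) b" and k: "a + b < k"
  shows "colors (delete_edge (graph_join G H) {u, v}) (verts G \<union> verts H) k"
proof -
  let ?J = "graph_join G H" and ?X = "verts G - {u} \<union> (verts H - {v})"
  have "colors ?J ?X (a + b)"
    using colors_join[OF s dj, of "verts G - {u}" "verts H - {v}"] a b by blast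
  then obtain c where c: "\<And>x. x \<in> ?X \<Longrightarrow> c x < a + b"
      "\<And>x y. x \<in> ?X \<Longrightarrow> y \<in> ?X \<Longrightarrow> {x, y} \<in> edges ?J \<Longrightarrow> c x \<noteq> c y"
    by (rule colorsE) blast
  let ?f = "\<lambda>x. if x = u \<or> x = v then a + b else c x"
  have less: "c x < a + b" if "x \<in> verts G \<union> verts H" "x \<noteq> u" "x \<noteq> v" for x
    using that c(1) by auto
  show ?thesis
  proof (rule colorsI[where c = ?f])
    show "?f x < k" if "x \<in> verts G \<union> verts H" for x using less[OF that] k by auto
  next
    fix x y assume xy: "x \<in> verts G \<union> verts H" "y \<in> verts G \<union> verts H"
      "{x, y} \<in> edges (delete_edge ?J {u, v})"
    have e: "{x, y} \<in> edges ?J" "{x, y} \<noteq> {u, v}" using xy(3) by (auto simp: delete_edge_def)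
    have "x \<noteq> y"
    proof
      assume "x = y"
      then have "{x, x} \<in> edges ?J" using e(1) by simp
      then show False using xy(1) edges_union_join(4,5)[OF s dj, of x x]
          simple_edgeD(3)[OF s(1), of x x] simple_edgeD(3)[OF s(2), of x x] by blast
    qed
    with e(2) have "\<not> ((x = u \<or> x = v) \<and> (y = u \<or> y = v))" by auto
    then show "?f x \<noteq> ?f y" using less[of x] less[of y] xy(1,2) c(2)[of x y] e(1) by auto
  qed
qed

text \<open>\<open>k\<close> must vary in the induction: inside a join the other side uses up its
  chromatic number, and the hypothesis is applied with the colours that remain. In a union, a part
  that needs more than \<open>k\<close> colours contains both vertices, and the other part is
  \<open>k\<close>-colourable as it stands.\<close>

lemma edge_critical_if_critical:
  assumes "cograph G" "u \<in> verts G" "v \<in> verts G" "u \<noteq> v"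
    "\<not> colors G (verts G) k" "colors G (verts G - {u}) k" "colors G (verts G - {v}) k"
  shows "colors (delete_edge G {u, v}) (verts G) k"
  using assms
proof (induction arbitrary: u v k rule: cograph.induct)
  case (single v)
  then show ?case by auto
next
  case (union G H)
  \<comment> \<open>Stated for arbitrary \<open>G\<close> and \<open>H\<close>, so that by
    commutativity of the union it also covers the case that \<open>H\<close> is the part needing
    more than \<open>k\<close> colours.\<close>
  have *: "colors (delete_edge (disjoint_union G H) {u, v}) (verts (disjoint_union G H)) k"
    if s: "simple_graph G" "simple_graph H" and dj: "verts G \<inter> verts H = {}"
      and IH: "\<And>u v k. u \<in> verts G \<Longrightarrow> v \<in> verts G \<Longrightarrow> u \<noteq> v \<Longrightarrow> \<not> colors G (verts G) k \<Longrightarrow>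
        colors G (verts G - {u}) k \<Longrightarrow> colors G (verts G - {v}) k \<Longrightarrow> colors (delete_edge G {u, v}) (verts G) k"
      and uv: "u \<in> verts (disjoint_union G H)" "v \<in> verts (disjoint_union G H)" "u \<noteq> v"
      and n: "\<not> colors G (verts G) k"
      and c: "colors (disjoint_union G H) (verts (disjoint_union G H) - {u}) k"
        "colors (disjoint_union G H) (verts (disjoint_union G H) - {v}) k"
    for G H :: "'a graph" and u v k
  proof -
    let ?D = "disjoint_union G H"
    note E = edges_union_join[OF s dj]
    have V: "verts ?D = verts G \<union> verts H" by (simp add: disjoint_union_def)
    have cG: "colors ?D X k = colors G X k" if "X \<subseteq> verts G" for X
      using that E(1) by (intro colors_cong_edges) blast
    have cH: "colors ?D X k = colors H X k" if "X \<subseteq> verts H" for X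
      using that E(2) by (intro colors_cong_edges) blast
    \<comment> \<open>If \<open>x\<close> lay outside \<open>G\<close>, all of \<open>G\<close>
      would remain after its deletion, contrary to fact \<open>n\<close>.\<close>
    have G: "x \<in> verts G \<and> colors G (verts G - {x}) k" if "colors ?D (verts ?D - {x}) k" for x
    proof -
      have "colors G (verts G - {x}) k"
        using colors_mono[OF that, of "verts G - {x}" k] V cG by blast
      moreover have "x \<in> verts G"
      proof (rule ccontr)
        assume "x \<notin> verts G"
        then have "verts G - {x} = verts G" by blast
        then show False using calculation n by simp
      qed
      ultimately show ?thesis by blast
    qed
    have g: "colors (delete_edge G {u, v}) (verts G) k" using G[OF c(1)] G[OF c(2)] IH uv n by blast
    have "u \<notin> verts H" using G[OF c(1)] dj by blast
    then have h: "colors H (verts H) k"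
      using colors_mono[OF c(1), of "verts H" k] V cH by blast
    have "simple_graph (delete_edge G {u, v})" using simple_delete_edge s(1) .
    then have "colors (disjoint_union (delete_edge G {u, v}) H) (verts G \<union> verts H) k"
      using colors_disjoint_union[OF _ s(2) _ _ _ g h] dj by (simp add: delete_edge_def)
    then show ?thesis
      unfolding V by (rule colors_antimono_edges) (auto simp: disjoint_union_def delete_edge_def)
  qed
  have s: "simple_graph G" "simple_graph H" using union.hyps cograph_simple_graph by blast+
  have "\<not> colors G (verts G) k \<or> \<not> colors H (verts H) k"
    using union.prems(4) colors_disjoint_union[OF s union.hyps(3) order.refl order.refl]
    by (auto simp: disjoint_union_def)
  then show ?case
  proof
    assume "\<not> colors G (verts G) k"
    then show ?thesis
      by (intro *[OF s union.hyps(3) union.IH(1) union.prems(1-3) _ union.prems(5,6)])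
  next
    have dj': "verts H \<inter> verts G = {}" using union.hyps(3) by blast
    assume "\<not> colors H (verts H) k"
    then show ?thesis
      using union.prems unfolding disjoint_union_commute[of G H]
      by (intro *[OF s(2,1) dj' union.IH(2)])
  qed
next
  case (join G H)
  have same: "colors (delete_edge (graph_join G H) {u, v}) (verts (graph_join G H)) k"
    if s: "simple_graph G" "simple_graph H" and dj: "verts G \<inter> verts H = {}"
      and IH: "\<And>u v k. u \<in> verts G \<Longrightarrow> v \<in> verts G \<Longrightarrow> u \<noteq> v \<Longrightarrow> \<not> colors G (verts G) k \<Longrightarrow>
        colors G (verts G - {u}) k \<Longrightarrow> colors G (verts G - {v}) k \<Longrightarrow> colors (delete_edge G {u, v}) (verts G) k"
      and uv: "u \<in> verts G" "v \<in> verts G" "u \<noteq> v"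
      and n: "\<not> colors (graph_join G H) (verts (graph_join G H)) k"
      and c: "colors (graph_join G H) (verts (graph_join G H) - {u}) k"
        "colors (graph_join G H) (verts (graph_join G H) - {v}) k"
    for G H :: "'a graph" and u v k
  proof -
    let ?J = "graph_join G H"
    have V: "verts ?J = verts G \<union> verts H" by (simp add: graph_join_def)
    \<comment> \<open>Every colouring of the join spends at least \<open>b\<close> colours on
      \<open>H\<close>. The inequality \<open>b \<le> k\<close> is recorded along with the bound
      \<open>k - b\<close> because subtraction is truncated.\<close>
    define b where "b = chromatic_number H"
    have b: "colors H (verts H) b" using chromatic_number_le_iff[OF s(2)] b_def by blast
    have G: "b \<le> k \<and> colors G (verts G - {x}) (k - b)"
      if x: "x \<in> verts G" "colors ?J (verts ?J - {x}) k" for x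
    proof -
      have "verts ?J - {x} = (verts G - {x}) \<union> verts H" using x(1) dj V by blast
      then obtain a b' where "a + b' \<le> k" "colors G (verts G - {x}) a" "colors H (verts H) b'"
        using x(2) colors_join[OF s dj, of "verts G - {x}" "verts H"] by auto
      moreover have "b \<le> b'" using chromatic_number_le_iff[OF s(2)] b_def calculation(3) by blast
      ultimately show ?thesis using colors_mono[of G "verts G - {x}" a _ "k - b"] by auto
    qed
    have "\<not> colors G (verts G) (k - b)"
      using n b G[OF uv(1) c(1)] colors_join[OF s dj order.refl order.refl, of k] V by auto
    then have g: "colors (delete_edge G {u, v}) (verts G) (k - b)"
      using IH[OF uv] G[OF uv(1) c(1)] G[OF uv(2) c(2)] by blast
    have sd: "simple_graph (delete_edge G {u, v})" using simple_delete_edge s(1) .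
    have vd: "verts (delete_edge G {u, v}) = verts G" by (simp add: delete_edge_def)
    have "k - b + b \<le> k" using G[OF uv(1) c(1)] by simp
    then have "colors (graph_join (delete_edge G {u, v}) H) (verts G \<union> verts H) k"
      using colors_join[OF sd s(2), of "verts G" "verts H" k] vd dj g b by blast
    then show ?thesis
      unfolding V by (rule colors_antimono_edges) (auto simp: graph_join_def delete_edge_def)
  qed
  have cross: "colors (delete_edge (graph_join G H) {u, v}) (verts (graph_join G H)) k"
    if s: "simple_graph G" "simple_graph H" and dj: "verts G \<inter> verts H = {}"
      and uv: "u \<in> verts G" "v \<in> verts H"
      and n: "\<not> colors (graph_join G H) (verts (graph_join G H)) k"
      and c: "colors (graph_join G H) (verts (graph_join G H) - {u}) k"
        "colors (graph_join G H) (verts (graph_join G H) - {v}) k"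
    for G H :: "'a graph" and u v k
  proof -
    let ?J = "graph_join G H"
    have V: "verts ?J = verts G \<union> verts H" by (simp add: graph_join_def)
    have "verts ?J - {u} = (verts G - {u}) \<union> verts H" "verts ?J - {v} = verts G \<union> (verts H - {v})"
      using uv dj V by blast+
    then obtain a b a' b' where ab: "a + b \<le> k" "colors G (verts G - {u}) a" "colors H (verts H) b"
      and ab': "a' + b' \<le> k" "colors G (verts G) a'" "colors H (verts H - {v}) b'"
      using c colors_join[OF s dj, of "verts G - {u}" "verts H"]
        colors_join[OF s dj, of "verts G" "verts H - {v}"] by auto
    \<comment> \<open>Otherwise \<open>a'\<close> colours on \<open>G\<close> and \<open>b\<close>
      on \<open>H\<close> would do for the join. Together with the sum of
      \<open>a + b \<le> k\<close> and \<open>a' + b' \<le> k\<close> this yields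
      \<open>a + b' < k\<close>, which leaves one colour to be shared by \<open>u\<close> and
      \<open>v\<close>.\<close>
    have "k < a' + b"
      using n colors_join[OF s dj order.refl order.refl, of k] V ab(3) ab'(2) by (metis linorder_not_less)
    then show ?thesis
      using colors_delete_edge_join[OF s dj uv ab(2) ab'(3), of k] ab(1) ab'(1) V by simp
  qed
  have s: "simple_graph G" "simple_graph H" using join.hyps cograph_simple_graph by blast+
  have dj': "verts H \<inter> verts G = {}" using join.hyps(3) by blast
  have V: "verts (graph_join G H) = verts G \<union> verts H" by (simp add: graph_join_def)
  consider "u \<in> verts G" "v \<in> verts G" | "u \<in> verts G" "v \<in> verts H" | "u \<in> verts H" "v \<in> verts G"
    | "u \<in> verts H" "v \<in> verts H" using join.prems(1,2) V by blast
  then show ?case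
  proof cases
    case 1 then show ?thesis
      using join.prems(3-6) by (intro same[OF s join.hyps(3) join.IH(1)])
  next
    case 2 then show ?thesis using join.prems(4-6) by (intro cross[OF s join.hyps(3)])
  next
    case 3 then show ?thesis
      using join.prems(4-6) unfolding graph_join_commute[of G H] by (intro cross[OF s(2,1) dj'])
  next
    case 4 then show ?thesis
      using join.prems(3-6) unfolding graph_join_commute[of G H]
      by (intro same[OF s(2,1) dj' join.IH(2)])
  qed
qed

theorem chi_stable_iff_card_critical:
  assumes "cograph G"
  shows "chi_stable G \<longleftrightarrow> card {u \<in> verts G. critical G u} \<le> 1"
proof -
  have s: "simple_graph G" using assms cograph_simple_graph by blast
  have fin: "finite {u \<in> verts G. critical G u}" using s by (simp add: simple_graph_def)
  have "\<not> chi_stable G \<longleftrightarrow> (\<exists>u v. u \<noteq> v \<and> u \<in> verts G \<and> v \<in> verts G \<and> critical G u \<and> critical G v)"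
  proof
    assume "\<not> chi_stable G"
    then obtain e k where e: "e \<in> edges G" "colors (delete_edge G e) (verts G) k" "\<not> colors G (verts G) k"
      using not_chi_stable_iff[OF s] by blast
    obtain u v where uv: "e = {u, v}" using e(1) s by (auto simp: simple_graph_def card_2_iff)
    then have "{v, u} = e" by blast
    then have "critical G u" "critical G v"
      using e critical_if_edge_critical[OF s] uv unfolding critical_def by metis+
    then show "\<exists>u v. u \<noteq> v \<and> u \<in> verts G \<and> v \<in> verts G \<and> critical G u \<and> critical G v"
      using simple_edgeD[OF s] e(1) uv by blast
  next
    assume "\<exists>u v. u \<noteq> v \<and> u \<in> verts G \<and> v \<in> verts G \<and> critical G u \<and> critical G v"
    then obtain u v k l where uv: "u \<noteq> v" "u \<in> verts G" "v \<in> verts G"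
      and k: "colors G (verts G - {u}) k" "\<not> colors G (verts G) k"
      and l: "colors G (verts G - {v}) l" "\<not> colors G (verts G) l"
      unfolding critical_def by blast
    \<comment> \<open>Both numbers are one less than the chromatic number, so the two vertices are
      critical at the same bound.\<close>
    have "l < Suc k" "k < Suc l"
      using colors_Suc_insert[OF k(1) s] colors_Suc_insert[OF l(1) s] k(2) l(2) colors_mono
      by (metis linorder_not_less order.refl)+
    then have "l = k" by simp
    with edge_critical_if_critical[OF assms uv(2,3,1) k(2,1)] l
    have c: "colors (delete_edge G {u, v}) (verts G) k" by blast
    \<comment> \<open>Were they not adjacent, deleting the pair would change nothing and
      \<open>G\<close> itself would be \<open>k\<close>-colourable.\<close>
    have "{u, v} \<in> edges G"
    proof (rule ccontr)
      assume "{u, v} \<notin> edges G"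
      then have "delete_edge G {u, v} = G" by (simp add: delete_edge_def)
      with c k show False by simp
    qed
    then show "\<not> chi_stable G" using not_chi_stable_iff[OF s] c k by blast
  qed
  then show ?thesis using card_le_Suc0_iff_eq[OF fin] by auto
qed

section \<open>Cliques and maximal independent sets in co-graphs\<close>

lemma cliqueI: "(\<And>u v. u \<in> Q \<Longrightarrow> v \<in> Q \<Longrightarrow> u \<noteq> v \<Longrightarrow> {u, v} \<in> edges G) \<Longrightarrow> clique G Q"
  by (simp add: clique_def)

lemma cliqueD: "clique G Q \<Longrightarrow> u \<in> Q \<Longrightarrow> v \<in> Q \<Longrightarrow> u \<noteq> v \<Longrightarrow> {u, v} \<in> edges G"
  by (simp add: clique_def)

lemma maximal_indepD:
  assumes "maximal_indep G R I"
  shows "I \<subseteq> R" "\<And>u v. u \<in> I \<Longrightarrow> v \<in> I \<Longrightarrow> {u, v} \<notin> edges G"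
    "\<And>u. u \<in> R - I \<Longrightarrow> \<exists>v\<in>I. {u, v} \<in> edges G"
  using assms unfolding maximal_indep_def by simp_all

lemma maximal_indepI:
  assumes "I \<subseteq> R" "\<And>u v. u \<in> I \<Longrightarrow> v \<in> I \<Longrightarrow> {u, v} \<notin> edges G"
    "\<And>u. u \<in> R - I \<Longrightarrow> \<exists>v\<in>I. {u, v} \<in> edges G"
  shows "maximal_indep G R I"
  using assms unfolding maximal_indep_def by simp

text \<open>Behind this is the fact that in every induced subgraph of a co-graph each maximal clique
  meets each maximal independent set; only the size is claimed, and \<open>Q'\<close> need not
  contain \<open>Q\<close>. In a union a nonempty clique lies in one part, and \<open>I\<close>
  stays maximal there. In a join it is \<open>I\<close> that lies on one side: the clique is
  enlarged on this side, and its vertices on the other side are kept.\<close>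

lemma clique_extend:
  assumes "cograph G" "R \<subseteq> verts G" "R \<noteq> {}" "maximal_indep G R I" "clique G Q" "Q \<subseteq> R - I"
  shows "\<exists>Q'\<subseteq>R. clique G Q' \<and> card Q' = Suc (card Q)"
  using assms
proof (induction arbitrary: R I Q rule: cograph.induct)
  case (single v)
  then have "R = {v}" "I = {v}" by (auto simp: maximal_indep_def)
  with single show ?case by (intro exI[of _ "{v}"]) (auto simp: clique_def)
next
  case (union G H)
  have *: "\<exists>Q'\<subseteq>R. clique (disjoint_union G H) Q' \<and> card Q' = Suc (card Q)"
    if s: "simple_graph G" "simple_graph H" and dj: "verts G \<inter> verts H = {}"
      and IH: "\<And>R I Q. R \<subseteq> verts G \<Longrightarrow> R \<noteq> {} \<Longrightarrow> maximal_indep G R I \<Longrightarrow> clique G Q \<Longrightarrow>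
            Q \<subseteq> R - I \<Longrightarrow> \<exists>Q'\<subseteq>R. clique G Q' \<and> card Q' = Suc (card Q)"
      and p: "R \<subseteq> verts (disjoint_union G H)" "maximal_indep (disjoint_union G H) R I"
        "clique (disjoint_union G H) Q" "Q \<subseteq> R - I" and q: "q \<in> Q" "q \<in> verts G"
    for G H :: "'a graph" and R I Q q
  proof -
    note E = edges_union_join[OF s dj]
    have V: "verts (disjoint_union G H) = verts G \<union> verts H" by (simp add: disjoint_union_def)
    have Q: "Q \<subseteq> verts G"
    proof
      fix x assume x: "x \<in> Q"
      show "x \<in> verts G"
      proof (rule ccontr)
        assume n: "x \<notin> verts G"
        then have "x \<in> verts H" using x p(1,4) V by blast
        moreover have "x \<noteq> q" using n q by blast
        ultimately show False using cliqueD[OF p(3) q(1) x] E(3)[OF q(2), of x] by simp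
      qed
    qed
    have "maximal_indep G (R \<inter> verts G) (I \<inter> verts G)"
    proof (rule maximal_indepI)
      show "I \<inter> verts G \<subseteq> R \<inter> verts G" using maximal_indepD(1)[OF p(2)] by blast
    next
      fix u v assume "u \<in> I \<inter> verts G" "v \<in> I \<inter> verts G"
      then show "{u, v} \<notin> edges G" using maximal_indepD(2)[OF p(2), of u v] E(1)[of u v] by simp
    next
      fix u assume u: "u \<in> R \<inter> verts G - I \<inter> verts G"
      then obtain v where v: "v \<in> I" "{u, v} \<in> edges (disjoint_union G H)"
        using maximal_indepD(3)[OF p(2), of u] by blast
      have "v \<in> verts G \<union> verts H" using v(1) p(1) maximal_indepD(1)[OF p(2)] V by blast
      then have "v \<in> verts G" using E(3)[of u v] u v by blast
      then show "\<exists>v\<in>I \<inter> verts G. {u, v} \<in> edges G" using v E(1)[of u v] u by blast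
    qed
    moreover have "clique G Q"
      by (rule cliqueI) (use cliqueD[OF p(3)] Q E(1) in blast)
    ultimately have "\<exists>Q'\<subseteq>R \<inter> verts G. clique G Q' \<and> card Q' = Suc (card Q)"
      using p(4) q Q by (intro IH[of _ "I \<inter> verts G"]) auto
    then obtain Q' where "Q' \<subseteq> R \<inter> verts G" "clique G Q'" "card Q' = Suc (card Q)" by blast
    moreover have "clique (disjoint_union G H) Q'"
      by (rule cliqueI) (use calculation(1) cliqueD[OF calculation(2)] E(1) in blast)
    ultimately show ?thesis by blast
  qed
  have s: "simple_graph G" "simple_graph H" using union.hyps cograph_simple_graph by blast+
  \<comment> \<open>An empty clique does not single out a part, but any vertex of \<open>R\<close>
    is a clique of size 1.\<close>
  show ?case
  proof (cases "Q = {}")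
    case True
    obtain x where "x \<in> R" using union.prems(2) by blast
    then show ?thesis using True by (intro exI[of _ "{x}"]) (auto simp: clique_def)
  next
    case False
    then obtain q where q: "q \<in> Q" by blast
    then have "q \<in> verts G \<or> q \<in> verts H"
      using union.prems(1,5) by (auto simp: disjoint_union_def)
    then show ?thesis
    proof
      assume "q \<in> verts G"
      then show ?thesis
        using union.prems(1,3-5) q by (intro *[OF s union.hyps(3) union.IH(1)])
    next
      have dj': "verts H \<inter> verts G = {}" using union.hyps(3) by blast
      assume "q \<in> verts H"
      then show ?thesis
        using union.prems(1,3-5) q unfolding disjoint_union_commute[of G H]
        by (intro *[OF s(2,1) dj' union.IH(2)])
    qed
  qed
next
  case (join G H)
  have *: "\<exists>Q'\<subseteq>R. clique (graph_join G H) Q' \<and> card Q' = Suc (card Q)"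
    if s: "simple_graph G" "simple_graph H" and dj: "verts G \<inter> verts H = {}"
      and IH: "\<And>R I Q. R \<subseteq> verts G \<Longrightarrow> R \<noteq> {} \<Longrightarrow> maximal_indep G R I \<Longrightarrow> clique G Q \<Longrightarrow>
            Q \<subseteq> R - I \<Longrightarrow> \<exists>Q'\<subseteq>R. clique G Q' \<and> card Q' = Suc (card Q)"
      and p: "R \<subseteq> verts (graph_join G H)" "maximal_indep (graph_join G H) R I"
        "clique (graph_join G H) Q" "Q \<subseteq> R - I" and q: "q \<in> I" "q \<in> verts G"
    for G H :: "'a graph" and R I Q q
  proof -
    note E = edges_union_join[OF s dj]
    have V: "verts (graph_join G H) = verts G \<union> verts H" by (simp add: graph_join_def)
    have IR: "I \<subseteq> R" using p(2) by (simp add: maximal_indep_def)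
    have I: "I \<subseteq> verts G"
    proof
      fix x assume x: "x \<in> I"
      show "x \<in> verts G"
      proof (rule ccontr)
        assume n: "x \<notin> verts G"
        then have "x \<in> verts H" using x p(1) IR V by blast
        then show False using maximal_indepD(2)[OF p(2) q(1) x] E(6)[OF q(2), of x] by simp
      qed
    qed
    have "maximal_indep G (R \<inter> verts G) I"
    proof (rule maximal_indepI)
      show "I \<subseteq> R \<inter> verts G" using IR I by blast
    next
      fix u v assume uv: "u \<in> I" "v \<in> I"
      then have "u \<in> verts G" "v \<in> verts G" using I by blast+
      then show "{u, v} \<notin> edges G" using maximal_indepD(2)[OF p(2) uv] E(4)[of u v] by simp
    next
      fix u assume u: "u \<in> R \<inter> verts G - I"
      then obtain v where v: "v \<in> I" "{u, v} \<in> edges (graph_join G H)"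
        using maximal_indepD(3)[OF p(2), of u] by blast
      then show "\<exists>v\<in>I. {u, v} \<in> edges G" using E(4)[of u v] u I by blast
    qed
    moreover have "clique G (Q \<inter> verts G)"
      by (rule cliqueI) (use cliqueD[OF p(3)] E(4) in blast)
    ultimately have "\<exists>Q'\<subseteq>R \<inter> verts G. clique G Q' \<and> card Q' = Suc (card (Q \<inter> verts G))"
      using p(4) q I IR by (intro IH[of _ I]) auto
    then obtain Q' where Q': "Q' \<subseteq> R \<inter> verts G" "clique G Q'" "card Q' = Suc (card (Q \<inter> verts G))" by blast
    have "clique (graph_join G H) (Q' \<union> (Q \<inter> verts H))"
    proof (rule cliqueI)
      fix x y assume xy: "x \<in> Q' \<union> Q \<inter> verts H" "y \<in> Q' \<union> Q \<inter> verts H" "x \<noteq> y"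
      consider "x \<in> Q'" "y \<in> Q'" | "x \<in> Q'" "y \<in> verts H" | "x \<in> verts H" "y \<in> Q'" | "x \<in> Q" "y \<in> Q"
        using xy by blast
      then show "{x, y} \<in> edges (graph_join G H)"
      proof cases
        case 1
        then have "x \<in> verts G" "y \<in> verts G" using Q'(1) by blast+
        then show ?thesis using cliqueD[OF Q'(2) 1 xy(3)] E(4)[of x y] by simp
      next
        case 2 then show ?thesis using Q'(1) E(6)[of x y] by blast
      next
        case 3 then have "{y, x} \<in> edges (graph_join G H)" using Q'(1) E(6)[of y x] by blast
        then show ?thesis by (simp only: insert_commute)
      next
        case 4 then show ?thesis using cliqueD[OF p(3)] xy(3) by blast
      qed
    qed
    moreover have "card (Q' \<union> (Q \<inter> verts H)) = Suc (card Q)"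
    proof -
      have fin: "finite (verts G)" "finite (verts H)" using s by (auto simp: simple_graph_def)
      have Q: "Q = (Q \<inter> verts G) \<union> (Q \<inter> verts H)" using p(1,4) V by blast
      have "card Q = card (Q \<inter> verts G) + card (Q \<inter> verts H)"
        by (subst Q, rule card_Un_disjoint) (use fin dj in auto)
      moreover have "card (Q' \<union> (Q \<inter> verts H)) = card Q' + card (Q \<inter> verts H)"
        by (rule card_Un_disjoint) (use fin dj Q'(1) in \<open>auto intro: finite_subset\<close>)
      ultimately show ?thesis using Q'(3) by simp
    qed
    ultimately show ?thesis using Q'(1) p(4) by (intro exI[of _ "Q' \<union> (Q \<inter> verts H)"]) blast
  qed
  have s: "simple_graph G" "simple_graph H" using join.hyps cograph_simple_graph by blast+
  \<comment> \<open>An empty \<open>I\<close> would leave the vertices of the nonempty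
    \<open>R\<close> without a neighbour in it.\<close>
  have "I \<noteq> {}" "I \<subseteq> R" using join.prems(2,3) by (auto simp: maximal_indep_def)
  then obtain q where q: "q \<in> I" "q \<in> verts G \<union> verts H"
    using join.prems(1) by (auto simp: graph_join_def)
  from q(2) show ?case
  proof
    assume "q \<in> verts G"
    then show ?thesis
      using join.prems(1,3-5) q(1) by (intro *[OF s join.hyps(3) join.IH(1)])
  next
    have dj': "verts H \<inter> verts G = {}" using join.hyps(3) by blast
    assume "q \<in> verts H"
    then show ?thesis
      using join.prems(1,3-5) q(1) unfolding graph_join_commute[of G H]
      by (intro *[OF s(2,1) dj' join.IH(2)])
  qed
qed

section \<open>Greedy colouring as a test for critical vertices\<close>

lemma colors_Un_indep:
  assumes "colors G D m" "\<And>u v. u \<in> J \<Longrightarrow> v \<in> J \<Longrightarrow> {u, v} \<notin> edges G"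
  shows "colors G (D \<union> J) (Suc m)"
proof -
  obtain c where c: "\<And>x. x \<in> D \<Longrightarrow> c x < m"
      "\<And>u v. u \<in> D \<Longrightarrow> v \<in> D \<Longrightarrow> {u, v} \<in> edges G \<Longrightarrow> c u \<noteq> c v"
    using assms(1) by (rule colorsE) blast
  show ?thesis
  proof (rule colorsI[where c = "\<lambda>x. if x \<in> D then c x else m"])
    show "(if x \<in> D then c x else m) < Suc m" if "x \<in> D \<union> J" for x
      using c(1)[of x] by (simp add: less_Suc_eq)
    show "(if u \<in> D then c u else m) \<noteq> (if v \<in> D then c v else m)"
      if "u \<in> D \<union> J" "v \<in> D \<union> J" "{u, v} \<in> edges G" for u v
      using that c(1)[of u] c(1)[of v] c(2)[of u v] assms(2)[of u v] by auto
  qed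
qed

text \<open>
  \<open>D\<close> is the union of the first \<open>m\<close> classes of a greedy colouring of \<open>G - u\<close>, and \<open>ok\<close> says that
  each of them contains a neighbour of \<open>u\<close>. The clique conditions are phrased so that they
  can be carried forward class by class; for \<open>D = V - {u}\<close> they yield a clique with one vertex
  per class.
\<close>

definition greedy_state :: "'v graph \<Rightarrow> 'v \<Rightarrow> 'v set \<Rightarrow> nat \<Rightarrow> bool \<Rightarrow> bool" where
  "greedy_state G u D m ok \<longleftrightarrow> D \<subseteq> verts G - {u} \<and> colors G D m \<and>
     (\<forall>Q\<subseteq>verts G - {u} - D. clique G Q \<longrightarrow>
        (\<exists>Q'\<subseteq>verts G - {u}. clique G Q' \<and> card Q' = card Q + m)) \<and>
     (ok \<longrightarrow> (\<forall>Q\<subseteq>verts G - D. clique G Q \<longrightarrow>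
        (\<exists>Q'\<subseteq>verts G. clique G Q' \<and> card Q' = card Q + m))) \<and>
     (\<not> ok \<longrightarrow> colors G (insert u D) m)"

lemma greedy_state_init: "greedy_state G u {} 0 True"
  unfolding greedy_state_def colors_def by auto

text \<open>The new class costs one more colour, and \<open>clique_extend\<close> makes up for it by
  one more clique vertex. If \<open>u\<close> has a neighbour in \<open>I\<close>, then
  \<open>I\<close> is maximal independent in \<open>insert u R\<close> too, so the same exchange
  works with \<open>u\<close> present. If not, \<open>u\<close> can be put into this class, and once
  it has found a class it stays there.\<close>

lemma greedy_state_step:
  assumes G: "cograph G" and u: "u \<in> verts G" and inv: "greedy_state G u D m ok"
    and R: "R = verts G - {u} - D" "R \<noteq> {}" and I: "maximal_indep G R I"
    and ok': "ok' \<longleftrightarrow> ok \<and> (\<exists>v\<in>I. {u, v} \<in> edges G)"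
  shows "greedy_state G u (D \<union> I) (Suc m) ok'"
proof -
  have D: "D \<subseteq> verts G - {u}" and cD: "colors G D m"
    and Q0: "\<And>Q. Q \<subseteq> R \<Longrightarrow> clique G Q \<Longrightarrow> \<exists>Q'\<subseteq>verts G - {u}. clique G Q' \<and> card Q' = card Q + m"
    and Q1: "\<And>Q. ok \<Longrightarrow> Q \<subseteq> verts G - D \<Longrightarrow> clique G Q \<Longrightarrow> \<exists>Q'\<subseteq>verts G. clique G Q' \<and> card Q' = card Q + m"
    and cu: "\<not> ok \<Longrightarrow> colors G (insert u D) m"
    using inv unfolding greedy_state_def R(1) by simp_all
  note I' = maximal_indepD[OF I]
  have s: "simple_graph G" using G by (rule cograph_simple_graph)
  have V: "verts G - D = insert u R" using u D R by blast
  show ?thesis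
    unfolding greedy_state_def
  proof (intro conjI impI allI)
    show "D \<union> I \<subseteq> verts G - {u}" using D I'(1) R by blast
    show "colors G (D \<union> I) (Suc m)" using colors_Un_indep[OF cD I'(2)] .
  next
    fix Q assume Q: "Q \<subseteq> verts G - {u} - (D \<union> I)" "clique G Q"
    have RV: "R \<subseteq> verts G" using R by blast
    have "Q \<subseteq> R - I" using Q(1) R by blast
    from clique_extend[OF G RV R(2) I Q(2) this]
    obtain Q1 where "Q1 \<subseteq> R" "clique G Q1" "card Q1 = Suc (card Q)" by blast
    then show "\<exists>Q'\<subseteq>verts G - {u}. clique G Q' \<and> card Q' = card Q + Suc m" using Q0[of Q1] by simp
  next
    fix Q assume o: ok' and Q: "Q \<subseteq> verts G - (D \<union> I)" "clique G Q"
    have "maximal_indep G (insert u R) I"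
    proof (rule maximal_indepI)
      show "I \<subseteq> insert u R" using I'(1) by blast
      show "{x, y} \<notin> edges G" if "x \<in> I" "y \<in> I" for x y using I'(2) that .
      show "\<exists>v\<in>I. {x, v} \<in> edges G" if "x \<in> insert u R - I" for x
        using I'(3)[of x] o ok' that by blast
    qed
    moreover have "insert u R \<subseteq> verts G" using R u by blast
    moreover have "Q \<subseteq> insert u R - I" using Q(1) V by blast
    ultimately obtain Q1 where "Q1 \<subseteq> insert u R" "clique G Q1" "card Q1 = Suc (card Q)"
      using clique_extend[OF G, of "insert u R" I Q] Q(2) by blast
    then show "\<exists>Q'\<subseteq>verts G. clique G Q' \<and> card Q' = card Q + Suc m"
      using Q1[of Q1] o ok' V by simp
  next
    assume no: "\<not> ok'"
    show "colors G (insert u (D \<union> I)) (Suc m)"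
    proof (cases ok)
      case True
      then have n: "{u, v} \<notin> edges G" if "v \<in> I" for v using no ok' that by blast
      then have n': "{v, u} \<notin> edges G" if "v \<in> I" for v using n[OF that] insert_commute[of u v "{}"] by simp
      have "colors G (D \<union> insert u I) (Suc m)"
      proof (rule colors_Un_indep[OF cD])
        fix x y assume "x \<in> insert u I" "y \<in> insert u I"
        then show "{x, y} \<notin> edges G"
          using n[of y] n'[of x] I'(2)[of x y] simple_edgeD(3)[OF s, of u u] by blast
      qed
      then show ?thesis by simp
    next
      case False
      then show ?thesis using colors_Un_indep[OF cu I'(2)] by simp
    qed
  qed
qed

text \<open>The clique conditions are used at \<open>Q = {}\<close> and \<open>Q = {u}\<close>. They
  give cliques of size \<open>m\<close> avoiding \<open>u\<close> and, under \<open>ok\<close>, of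
  size \<open>m + 1\<close> in \<open>G\<close>, which bound the numbers of colours from
  below.\<close>

lemma greedy_state_final:
  assumes "u \<in> verts G" "greedy_state G u (verts G - {u}) m ok"
  shows "critical G u \<longleftrightarrow> ok"
proof -
  have c: "colors G (verts G - {u}) m"
    and Q0: "\<exists>Q\<subseteq>verts G - {u}. clique G Q \<and> card Q = m"
    and Q1: "ok \<Longrightarrow> \<exists>Q\<subseteq>verts G. clique G Q \<and> card Q = Suc m"
    and cu: "\<not> ok \<Longrightarrow> colors G (verts G) m"
  proof -
    note i = assms(2)[unfolded greedy_state_def]
    show "colors G (verts G - {u}) m" using i by blast
    have "clique G {}" by (simp add: clique_def)
    then show "\<exists>Q\<subseteq>verts G - {u}. clique G Q \<and> card Q = m"
      using i by (metis add_0 card.empty empty_subsetI)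
    have "clique G {u}" by (simp add: clique_def)
    moreover have "{u} \<subseteq> verts G - (verts G - {u})" using assms(1) by blast
    ultimately have "ok \<Longrightarrow> \<exists>Q\<subseteq>verts G. clique G Q \<and> card Q = card {u} + m"
      using i by blast
    then show "ok \<Longrightarrow> \<exists>Q\<subseteq>verts G. clique G Q \<and> card Q = Suc m" by simp
    have "insert u (verts G - {u}) = verts G" using assms(1) by blast
    then show "\<not> ok \<Longrightarrow> colors G (verts G) m" using i by simp
  qed
  show ?thesis
  proof
    assume "critical G u"
    then obtain k where k: "colors G (verts G - {u}) k" "\<not> colors G (verts G) k"
      unfolding critical_def by blast
    have "m \<le> k" using Q0 clique_card_le_colors[OF _ _ k(1)] by blast
    then show ok using cu colors_mono[of G "verts G" m "verts G" k] k(2) by blast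
  next
    assume ok
    then have "\<not> colors G (verts G) m" using Q1 clique_card_le_colors[of G _ "verts G" m] by fastforce
    then show "critical G u" unfolding critical_def using c by blast
  qed
qed

section \<open>Structured programs on Turing machine tapes\<close>

type_synonym store = "nat \<Rightarrow> tape"

text \<open>Designed so that each step of a program is one machine transition, with at most one tape
  acted upon and the others idle.\<close>

datatype code =
    Skip
  | Halt bool
  | Write nat nat
  | Move nat dir
  | Seq code code
  | Cond nat "nat set" code code
  | While nat "nat set" code

definition idle :: "(nat \<Rightarrow> nat) \<Rightarrow> nat \<Rightarrow> nat \<times> dir" where
  "idle r = (\<lambda>i. (r i, Stay))"

text \<open>\<open>Skip\<close> and \<open>Halt b\<close> are fixed points. A \<open>Seq\<close>
  spends a step of its own on passing from the finished first part to the second, which explains the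
  extra units in the time bounds.\<close>

fun code_step :: "code \<Rightarrow> (nat \<Rightarrow> nat) \<Rightarrow> code \<times> (nat \<Rightarrow> nat \<times> dir)" where
  "code_step Skip r = (Skip, idle r)"
| "code_step (Halt b) r = (Halt b, idle r)"
| "code_step (Write k s) r = (Skip, (idle r)(k := (s, Stay)))"
| "code_step (Move k d) r = (Skip, (idle r)(k := (r k, d)))"
| "code_step (Seq c d) r =
     (if c = Skip then (d, idle r) else (Seq (fst (code_step c r)) d, snd (code_step c r)))"
| "code_step (Cond k A c d) r = (if r k \<in> A then c else d, idle r)"
| "code_step (While k A c) r = (if r k \<in> A then Seq c (While k A c) else Skip, idle r)"

text \<open>The finitely many continuations of a program serve as the states of its machine.\<close>

fun reach :: "code \<Rightarrow> code set" where
  "reach Skip = {Skip}"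
| "reach (Halt b) = {Halt b}"
| "reach (Write k s) = {Write k s, Skip}"
| "reach (Move k d) = {Move k d, Skip}"
| "reach (Seq c d) = (\<lambda>x. Seq x d) ` reach c \<union> reach d"
| "reach (Cond k A c d) = insert (Cond k A c d) (reach c \<union> reach d)"
| "reach (While k A c) =
     insert Skip (insert (While k A c) ((\<lambda>x. Seq x (While k A c)) ` reach c))"

lemma finite_reach: "finite (reach c)"
  by (induction c) auto

lemma self_in_reach: "c \<in> reach c"
  by (induction c) auto

lemma reach_closed: "x \<in> reach c \<Longrightarrow> fst (code_step x r) \<in> reach c"
proof (induction c arbitrary: x)
  case (Seq c d)
  then show ?case using self_in_reach[of d] by auto
next
  case (Cond k A c d)
  then show ?case using self_in_reach[of c] self_in_reach[of d] by auto
next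
  case (While k A c)
  then show ?case using self_in_reach[of c] by (auto split: if_splits)
qed auto

fun code_ok :: "nat \<Rightarrow> nat \<Rightarrow> code \<Rightarrow> bool" where
  "code_ok m s Skip = True"
| "code_ok m s (Halt b) = True"
| "code_ok m s (Write k a) = (k < m \<and> a < s)"
| "code_ok m s (Move k d) = (k < m)"
| "code_ok m s (Seq c d) = (code_ok m s c \<and> code_ok m s d)"
| "code_ok m s (Cond k A c d) = (k < m \<and> code_ok m s c \<and> code_ok m s d)"
| "code_ok m s (While k A c) = (k < m \<and> code_ok m s c)"

lemma code_ok_reach: "code_ok m s c \<Longrightarrow> x \<in> reach c \<Longrightarrow> code_ok m s x"
proof -
  have "code_ok m s c \<Longrightarrow> Ball (reach c) (code_ok m s)"
  proof (induction c)
    case (Seq c d)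
    then have ok: "code_ok m s c" "code_ok m s d" unfolding code_ok.simps by blast+
    from Seq.IH(1)[OF ok(1)] Seq.IH(2)[OF ok(2)] ok show ?case by auto
  next
    case (Cond k A c d)
    then have ok: "k < m" "code_ok m s c" "code_ok m s d" unfolding code_ok.simps by blast+
    from Cond.IH(1)[OF ok(2)] Cond.IH(2)[OF ok(3)] ok show ?case by auto
  next
    case (While k A c)
    then have ok: "k < m" "code_ok m s c" unfolding code_ok.simps by blast+
    from While.IH[OF ok(2)] ok show ?case by auto
  qed simp_all
  then show "code_ok m s c \<Longrightarrow> x \<in> reach c \<Longrightarrow> code_ok m s x" by blast
qed

text \<open>A store has infinitely many tapes, the machine only \<open>m\<close>. A program confined
  to the first \<open>m\<close> does not notice that the list of read symbols ends there.\<close>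

lemma code_step_cong:
  assumes "code_ok m s c" "\<And>i. i < m \<Longrightarrow> r i = r' i"
  shows "fst (code_step c r) = fst (code_step c r')"
    "i < m \<Longrightarrow> snd (code_step c r) i = snd (code_step c r') i"
  using assms by (induction c) (auto simp: idle_def)

lemma code_step_symbol:
  assumes "code_ok m s c" "\<And>i. i < m \<Longrightarrow> r i < s" "i < m"
  shows "fst (snd (code_step c r) i) < s"
  using assms by (induction c) (auto simp: idle_def)

section \<open>Simulation of programs by Turing machines\<close>

definition cfg_step :: "code \<times> store \<Rightarrow> code \<times> store" where
  "cfg_step x = (fst (code_step (fst x) (\<lambda>i. read_tape (snd x i))),
     \<lambda>i. act_tape (snd (code_step (fst x) (\<lambda>i. read_tape (snd x i))) i) (snd x i))"

definition init_store :: "bool list \<Rightarrow> store" where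
  "init_store x = (\<lambda>i. if i = 0 then input_tape x else empty_tape)"

lemma act_tape_idle [simp]: "act_tape (idle (\<lambda>i. read_tape (\<sigma> i)) k) (\<sigma> k) = \<sigma> k"
  by (simp add: idle_def act_tape_def read_tape_def)

lemma act_tape_Pair: "act_tape (a, d) tp = ((fst tp)(snd tp := a), move_head d (snd tp))"
  by (simp add: act_tape_def)

lemma act_tape_read: "act_tape (read_tape tp, d) tp = (fst tp, move_head d (snd tp))"
  by (simp add: act_tape_def read_tape_def)

definition code_index :: "code list \<Rightarrow> code \<Rightarrow> nat" where
  "code_index cs c = (SOME i. i < length cs \<and> cs ! i = c)"

lemma code_index:
  assumes "c \<in> set cs"
  shows "code_index cs c < length cs" "cs ! code_index cs c = c"
  using someI_ex[of "\<lambda>i. i < length cs \<and> cs ! i = c"] assms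
  unfolding code_index_def in_set_conv_nth by blast+

lemma code_index_eq_iff:
  assumes "x \<in> set cs" "y \<in> set cs"
  shows "code_index cs x = code_index cs y \<longleftrightarrow> x = y"
  using code_index(2)[OF assms(1)] code_index(2)[OF assms(2)] by metis

definition code_tm :: "nat \<Rightarrow> nat \<Rightarrow> code list \<Rightarrow> tm" where
  "code_tm m s cs = \<lparr>num_tapes = m, num_symbols = s, num_states = length cs,
     accept_state = code_index cs (Halt True), reject_state = code_index cs (Halt False),
     delta = (\<lambda>q syms. (code_index cs (fst (code_step (cs ! q) (\<lambda>i. syms ! i))),
       map (snd (code_step (cs ! q) (\<lambda>i. syms ! i))) [0..<m]))\<rparr>"

text \<open>\<open>cs ! 0 = c\<close> lets the machine start in state 0 with the whole program, and
  \<open>halts\<close> makes the accepting and rejecting states two different positions of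
  \<open>cs\<close>.\<close>

locale code_machine =
  fixes m s :: nat and c :: code and cs :: "code list"
  assumes cs: "set cs = reach c" "distinct cs" "cs ! 0 = c"
    and ok: "code_ok m s c" and m: "m \<ge> 1" and s: "s \<ge> 4"
    and halts: "Halt True \<in> reach c" "Halt False \<in> reach c"
begin

abbreviation "M \<equiv> code_tm m s cs"

lemma index_nth: "i < length cs \<Longrightarrow> code_index cs (cs ! i) = i"
  using code_index[of "cs ! i" cs] cs(2) by (simp add: nth_eq_iff_index_eq)

lemma wf_tm: "wf_tm M"
proof -
  have "fst (delta M q syms) < num_states M \<and> length (snd (delta M q syms)) = num_tapes M \<and>
      (\<forall>(a, d) \<in> set (snd (delta M q syms)). a < num_symbols M)"
    if q: "q < num_states M" and l: "length syms = num_tapes M" and S: "set syms \<subseteq> {..<num_symbols M}"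
    for q syms
  proof -
    have q: "q < length cs" using q by (simp add: code_tm_def)
    then have "cs ! q \<in> reach c" using cs(1) nth_mem by blast
    then have r: "fst (code_step (cs ! q) ((!) syms)) \<in> set cs" and ok': "code_ok m s (cs ! q)"
      using reach_closed cs(1) code_ok_reach ok by blast+
    have l: "length syms = m" using l by (simp add: code_tm_def)
    have "syms ! i < s" if "i < m" for i
    proof -
      have "syms ! i \<in> set syms" using that l by simp
      then show ?thesis using S by (auto simp: code_tm_def)
    qed
    then have "fst (snd (code_step (cs ! q) ((!) syms)) i) < s" if "i < m" for i
      using code_step_symbol[OF ok'] that by blast
    moreover have "length (snd (delta M q syms)) = num_tapes M" by (simp add: code_tm_def)
    ultimately show ?thesis using code_index(1)[OF r] by (auto simp: code_tm_def split_beta)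
  qed
  moreover have "code_index cs (Halt True) \<noteq> code_index cs (Halt False)"
    using halts cs(1) by (simp add: code_index_eq_iff)
  moreover have "length cs \<ge> 1" using halts cs(1) by (cases cs) auto
  ultimately show ?thesis
    unfolding wf_tm_def using code_index(1)[of "Halt True" cs] code_index(1)[of "Halt False" cs] halts cs(1) m s
    by (simp add: code_tm_def)
qed

lemma halted_iff:
  assumes "d \<in> reach c"
  shows "halted M (code_index cs d, ts) \<longleftrightarrow> d = Halt True \<or> d = Halt False"
  using assms halts cs(1) by (simp add: halted_def code_tm_def code_index_eq_iff)

text \<open>On a halting continuation \<open>tm_step\<close> freezes the configuration and so does
  \<open>cfg_step\<close>; hence the simulation holds for any number of steps.\<close>

lemma step_simulation:
  assumes "d \<in> reach c"
  shows "tm_step M (code_index cs d, map \<sigma> [0..<m]) =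
    (code_index cs (fst (cfg_step (d, \<sigma>))), map (snd (cfg_step (d, \<sigma>))) [0..<m])"
proof (cases "d = Halt True \<or> d = Halt False")
  case True
  then have "cfg_step (d, \<sigma>) = (d, \<sigma>)" by (auto simp: cfg_step_def)
  then show ?thesis using halted_iff[OF assms] True by (simp add: tm_step_def)
next
  case False
  let ?r = "\<lambda>i. map read_tape (map \<sigma> [0..<m]) ! i" and ?r' = "\<lambda>i. read_tape (\<sigma> i)"
  have d: "cs ! code_index cs d = d" using code_index(2) assms cs(1) by blast
  have ok': "code_ok m s d" using code_ok_reach ok assms by blast
  have r: "?r i = ?r' i" if "i < m" for i using that by simp
  have "fst (code_step d ?r) = fst (code_step d ?r')"
    by (rule code_step_cong(1)[OF ok' r])
  moreover have "snd (code_step d ?r) i = snd (code_step d ?r') i" if "i < m" for i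
    by (rule code_step_cong(2)[OF ok' r that])
  then have "map (snd (code_step d ?r)) [0..<m] = map (snd (code_step d ?r')) [0..<m]" by simp
  ultimately have "delta M (code_index cs d) (map read_tape (map \<sigma> [0..<m])) =
      (code_index cs (fst (code_step d ?r')), map (snd (code_step d ?r')) [0..<m])"
    by (simp add: code_tm_def d)
  then show ?thesis using halted_iff[OF assms] False
    by (simp add: tm_step_def cfg_step_def zip_map_map zip_same_conv_map split_def)
qed

lemma simulation:
  "(cfg_step ^^ t) (c, init_store x) = (d, \<sigma>) \<Longrightarrow>
    d \<in> reach c \<and> config_after M x t = (code_index cs d, map \<sigma> [0..<m])"
proof (induction t arbitrary: d \<sigma>)
  case 0
  have "length cs > 0" using halts cs(1) by (cases cs) auto
  then have "code_index cs c = 0" using index_nth[of 0] cs(3) by simp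
  moreover have "map (init_store x) [0..<m] = input_tape x # replicate (m - 1) empty_tape"
    using m by (intro nth_equalityI) (auto simp: init_store_def nth_Cons')
  ultimately show ?case
    using 0 self_in_reach by (auto simp: config_after_def init_config_def code_tm_def)
next
  case (Suc t)
  obtain d' \<sigma>' where *: "(cfg_step ^^ t) (c, init_store x) = (d', \<sigma>')" by fastforce
  have IH: "d' \<in> reach c" "config_after M x t = (code_index cs d', map \<sigma>' [0..<m])"
    using Suc.IH[OF *] by auto
  have s': "cfg_step (d', \<sigma>') = (d, \<sigma>)" using Suc.prems * by simp
  then have "d \<in> reach c" using reach_closed[OF IH(1)] by (auto simp: cfg_step_def)
  moreover have "config_after M x (Suc t) = tm_step M (config_after M x t)"
    by (simp add: config_after_def)
  ultimately show ?case using step_simulation[OF IH(1), of \<sigma>'] IH(2) s' by simp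
qed

end

lemma ex_code_list:
  "\<exists>cs. set cs = reach c \<and> distinct cs \<and> cs ! 0 = c"
proof -
  obtain xs where "set xs = reach c - {c}" "distinct xs"
    using finite_distinct_list[of "reach c - {c}"] finite_reach by blast
  then show ?thesis using self_in_reach[of c] by (intro exI[of _ "c # xs"]) auto
qed

text \<open>Runs that end as soon as \<open>Skip\<close> is reached, so that they can be continued in a \<open>Seq\<close>.\<close>

inductive runs :: "nat \<Rightarrow> code \<times> store \<Rightarrow> code \<times> store \<Rightarrow> bool" where
  runs_refl: "runs 0 x x"
| runs_step: "fst x \<noteq> Skip \<Longrightarrow> runs n (cfg_step x) y \<Longrightarrow> runs (Suc n) x y"

lemma runs_funpow: "runs n x y \<Longrightarrow> (cfg_step ^^ n) x = y"
  by (induction rule: runs.induct) (simp_all add: funpow_swap1)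

lemma runs_trans: "runs n x y \<Longrightarrow> runs k y z \<Longrightarrow> runs (n + k) x z"
  by (induction rule: runs.induct) (auto intro: runs_step)

lemma runs_in_Seq:
  "runs n x y \<Longrightarrow> runs n (Seq (fst x) d, snd x) (Seq (fst y) d, snd y)"
proof (induction rule: runs.induct)
  case (runs_step x n y)
  then have "cfg_step (Seq (fst x) d, snd x) = (Seq (fst (cfg_step x)) d, snd (cfg_step x))"
    by (simp add: cfg_step_def)
  with runs_step show ?case by (intro runs.runs_step) simp_all
qed (rule runs_refl)

section \<open>Termination of programs with time bounds\<close>

definition terminates :: "code \<Rightarrow> store \<Rightarrow> nat \<Rightarrow> store \<Rightarrow> bool" where
  "terminates c \<sigma> t \<sigma>' \<longleftrightarrow> (\<exists>n\<le>t. runs n (c, \<sigma>) (Skip, \<sigma>'))"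

lemma terminates_mono: "terminates c \<sigma> t \<sigma>' \<Longrightarrow> t \<le> t' \<Longrightarrow> terminates c \<sigma> t' \<sigma>'"
  unfolding terminates_def by (meson order.trans)

lemma cfg_step_Seq_Skip: "cfg_step (Seq Skip d, \<sigma>) = (d, \<sigma>)"
  by (simp add: cfg_step_def)

lemma runs_Seq:
  assumes "terminates c \<sigma> t \<sigma>'"
  shows "\<exists>n\<le>Suc t. runs n (Seq c d, \<sigma>) (d, \<sigma>')"
proof -
  obtain n where n: "n \<le> t" "runs n (c, \<sigma>) (Skip, \<sigma>')" using assms terminates_def by auto
  have "runs (Suc 0) (Seq Skip d, \<sigma>') (d, \<sigma>')"
    by (rule runs_step) (simp_all add: cfg_step_Seq_Skip runs_refl)
  then have "runs (n + Suc 0) (Seq c d, \<sigma>) (d, \<sigma>')"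
    using runs_trans runs_in_Seq[OF n(2)] by fastforce
  then show ?thesis using n(1) by (intro exI[of _ "n + Suc 0"]) simp
qed

lemma terminates_Seq:
  assumes "terminates c \<sigma> t \<sigma>'" "terminates d \<sigma>' u \<sigma>''"
  shows "terminates (Seq c d) \<sigma> (Suc (t + u)) \<sigma>''"
proof -
  obtain n where n: "n \<le> Suc t" "runs n (Seq c d, \<sigma>) (d, \<sigma>')" using runs_Seq[OF assms(1)] by blast
  obtain k where k: "k \<le> u" "runs k (d, \<sigma>') (Skip, \<sigma>'')" using assms(2) terminates_def by auto
  show ?thesis unfolding terminates_def
    using runs_trans[OF n(2) k(2)] n(1) k(1) by (intro exI[of _ "n + k"]) simp
qed

lemma terminates_step:
  assumes "c \<noteq> Skip" "cfg_step (c, \<sigma>) = (d, \<tau>)" "terminates d \<tau> t \<sigma>'"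
  shows "terminates c \<sigma> (Suc t) \<sigma>'"
proof -
  obtain n where "n \<le> t" "runs n (d, \<tau>) (Skip, \<sigma>')" using assms(3) terminates_def by auto
  then show ?thesis unfolding terminates_def
    using assms(1,2) by (intro exI[of _ "Suc n"]) (auto intro: runs_step)
qed

lemma terminates_Skip: "terminates Skip \<sigma> 0 \<sigma>"
  unfolding terminates_def using runs_refl by blast

lemma terminates_single:
  "c \<noteq> Skip \<Longrightarrow> cfg_step (c, \<sigma>) = (Skip, \<sigma>') \<Longrightarrow> terminates c \<sigma> 1 \<sigma>'"
  using terminates_step[OF _ _ terminates_Skip] by simp

lemma terminates_Write: "terminates (Write k a) \<sigma> 1 (\<sigma>(k := ((fst (\<sigma> k))(snd (\<sigma> k) := a), snd (\<sigma> k))))"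
  by (rule terminates_single) (auto simp: cfg_step_def fun_eq_iff act_tape_Pair)

lemma terminates_Move: "terminates (Move k d) \<sigma> 1 (\<sigma>(k := (fst (\<sigma> k), move_head d (snd (\<sigma> k)))))"
  by (rule terminates_single) (auto simp: cfg_step_def fun_eq_iff act_tape_read)

lemma terminates_Cond:
  assumes "terminates (if read_tape (\<sigma> k) \<in> A then c else d) \<sigma> t \<sigma>'"
  shows "terminates (Cond k A c d) \<sigma> (Suc t) \<sigma>'"
  using assms by (intro terminates_step[of "Cond k A c d"]) (auto simp: cfg_step_def)

lemma terminates_While_False:
  assumes "read_tape (\<sigma> k) \<notin> A"
  shows "terminates (While k A c) \<sigma> 1 \<sigma>"
  using assms by (intro terminates_single) (auto simp: cfg_step_def)

lemma terminates_While_True: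
  assumes "read_tape (\<sigma> k) \<in> A" "terminates c \<sigma> t \<tau>" "terminates (While k A c) \<tau> u \<sigma>'"
  shows "terminates (While k A c) \<sigma> (t + u + 2) \<sigma>'"
  using terminates_step[of "While k A c", OF _ _ terminates_Seq[OF assms(2,3)]] assms(1)
  by (simp add: cfg_step_def)

text \<open>\<open>f i\<close> is the store before round \<open>i\<close>. A round costs its body
  plus two steps, for the test and for leaving the \<open>Seq\<close>; the last unit is the failing
  test.\<close>

lemma terminates_While_iterate:
  assumes "\<And>i. i < n \<Longrightarrow> read_tape (f i k) \<in> A \<and> terminates c (f i) t (f (Suc i))"
    and "read_tape (f n k) \<notin> A"
  shows "terminates (While k A c) (f 0) (n * (t + 2) + 1) (f n)"
  using assms
proof (induction n arbitrary: f)
  case 0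
  then show ?case using terminates_While_False by fastforce
next
  case (Suc n)
  have *: "terminates (While k A c) (f (Suc 0)) (n * (t + 2) + 1) (f (Suc n))"
    using Suc.IH[of "\<lambda>i. f (Suc i)"] Suc.prems by auto
  have "terminates (While k A c) (f 0) (t + (n * (t + 2) + 1) + 2) (f (Suc n))"
    using Suc.prems(1)[of 0] by (intro terminates_While_True[OF _ _ *]) auto
  then show ?case by (rule terminates_mono) simp
qed

section \<open>Programs with loops bounded by the input length\<close>

datatype prog =
    PWrite nat nat
  | PMove nat dir
  | PSeq prog prog (infixr \<open>;;\<close> 60)
  | PCond nat "nat set" prog prog
  | Repeat prog

fun exec :: "nat \<Rightarrow> prog \<Rightarrow> store \<Rightarrow> store" where
  "exec N (PWrite k a) \<sigma> = \<sigma>(k := ((fst (\<sigma> k))(snd (\<sigma> k) := a), snd (\<sigma> k)))"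
| "exec N (PMove k d) \<sigma> = \<sigma>(k := (fst (\<sigma> k), move_head d (snd (\<sigma> k))))"
| "exec N (p ;; q) \<sigma> = exec N q (exec N p \<sigma>)"
| "exec N (PCond k A p q) \<sigma> = (if read_tape (\<sigma> k) \<in> A then exec N p \<sigma> else exec N q \<sigma>)"
| "exec N (Repeat p) \<sigma> = (exec N p ^^ N) \<sigma>"

fun prog_ok :: "nat \<Rightarrow> nat \<Rightarrow> prog \<Rightarrow> bool" where
  "prog_ok K s (PWrite k a) = (k < K \<and> a < s)"
| "prog_ok K s (PMove k d) = (k < K)"
| "prog_ok K s (p ;; q) = (prog_ok K s p \<and> prog_ok K s q)"
| "prog_ok K s (PCond k A p q) = (k < K \<and> prog_ok K s p \<and> prog_ok K s q)"
| "prog_ok K s (Repeat p) = prog_ok K s p"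

text \<open>The number of ruler tapes required. Loops that are not nested share a ruler, since every
  loop brings its ruler head back to cell 0.\<close>

fun height :: "prog \<Rightarrow> nat" where
  "height (PWrite k a) = 0"
| "height (PMove k d) = 0"
| "height (p ;; q) = max (height p) (height q)"
| "height (PCond k A p q) = max (height p) (height q)"
| "height (Repeat p) = Suc (height p)"

text \<open>Nested loops count on separate ruler tapes, which come after the first \<open>K\<close> tapes.\<close>

fun compile :: "nat \<Rightarrow> nat \<Rightarrow> prog \<Rightarrow> code" where
  "compile K d (PWrite k a) = Write k a"
| "compile K d (PMove k e) = Move k e"
| "compile K d (p ;; q) = Seq (compile K d p) (compile K d q)"
| "compile K d (PCond k A p q) = Cond k A (compile K d p) (compile K d q)"
| "compile K d (Repeat p) =
     Seq (Move (K + d) Move_Right)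
    (Seq (While (K + d) {2} (Seq (compile K (Suc d) p) (Move (K + d) Move_Right)))
         (While (K + d) {0, 2} (Move (K + d) Move_Left)))"

text \<open>The first blank ends the counting run and the start marker ends the way back, so a ruler
  can be used again unchanged.\<close>

definition ruler :: "nat \<Rightarrow> nat \<Rightarrow> nat" where
  "ruler N = (\<lambda>i. if i = 0 then start_sym else if i \<le> N then 2 else blank_sym)"

text \<open>Rulers are invisible to \<open>exec\<close>: changing such a tape commutes with running
  the body. This is what lets a compiled loop move its ruler head between rounds.\<close>

lemma exec_frame:
  assumes "prog_ok K s p" "K \<le> j"
  shows "exec N p (\<sigma>(j := t)) = (exec N p \<sigma>)(j := t)"
  using assms(1)
proof (induction p arbitrary: \<sigma>)
  case (Repeat p)
  have "(exec N p ^^ n) (\<sigma>(j := t)) = ((exec N p ^^ n) \<sigma>)(j := t)" for n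
    using Repeat by (induction n) auto
  then show ?case by (simp only: exec.simps)
qed (use assms(2) in \<open>auto simp: fun_upd_twist\<close>)

lemma exec_unchanged:
  assumes "prog_ok K s p" "K \<le> j"
  shows "exec N p \<sigma> j = \<sigma> j"
  using exec_frame[OF assms, of N \<sigma> "\<sigma> j"] by (metis fun_upd_same fun_upd_triv)

lemma exec_cong:
  assumes "prog_ok K s p" "\<forall>i<K. \<sigma> i = \<tau> i"
  shows "\<forall>i<K. exec N p \<sigma> i = exec N p \<tau> i"
  using assms
proof (induction p arbitrary: \<sigma> \<tau>)
  case (PSeq p q)
  have "\<forall>i<K. exec N p \<sigma> i = exec N p \<tau> i"
    using PSeq.IH(1)[OF _ PSeq.prems(2)] PSeq.prems(1) unfolding prog_ok.simps by blast
  then have "\<forall>i<K. exec N q (exec N p \<sigma>) i = exec N q (exec N p \<tau>) i"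
    using PSeq.IH(2) PSeq.prems(1) unfolding prog_ok.simps by blast
  then show ?case by simp
next
  case (PCond l A p q)
  then have ok: "l < K" "prog_ok K s p" "prog_ok K s q" unfolding prog_ok.simps by blast+
  then have "\<sigma> l = \<tau> l" using PCond.prems(2) by blast
  with PCond.IH(1)[OF ok(2) PCond.prems(2)] PCond.IH(2)[OF ok(3) PCond.prems(2)]
  show ?case by simp
next
  case (Repeat p)
  have "\<forall>i<K. (exec N p ^^ n) \<sigma> i = (exec N p ^^ n) \<tau> i" for n
  proof (induction n)
    case (Suc n)
    from Repeat.IH[OF _ this] Repeat.prems(1)
    have "\<forall>i<K. exec N p ((exec N p ^^ n) \<sigma>) i = exec N p ((exec N p ^^ n) \<tau>) i" by simp
    then show ?case by simp
  qed (use Repeat.prems(2) in simp)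
  then show ?case by (simp only: exec.simps) 
qed auto

text \<open>The branches of a conditional are added because a pointwise maximum of polynomials need
  not be a polynomial. For \<open>Repeat\<close> with a body of cost \<open>c\<close>, the forward
  loop takes \<open>N * (c + 4) + 1\<close> steps and the way back \<open>3 * (N + 1) + 1\<close>;
  the remaining 3 are the first move and the two \<open>Seq\<close>.\<close>

fun cost :: "prog \<Rightarrow> nat poly" where
  "cost (PWrite k a) = 1"
| "cost (PMove k d) = 1"
| "cost (p ;; q) = cost p + cost q + 1"
| "cost (PCond k A p q) = cost p + cost q + 1"
| "cost (Repeat p) = [:0, 1:] * (cost p + [:4:]) + [:0, 3:] + [:8:]"

text \<open>Only the rulers from \<open>d\<close> on have to be at rest: those below
  \<open>d\<close> may be in use by enclosing loops, and the body of a loop is compiled with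
  \<open>Suc d\<close>.\<close>

lemma terminates_compile:
  assumes "prog_ok K s p" "height p + d \<le> D" "\<And>i. d \<le> i \<Longrightarrow> i < D \<Longrightarrow> \<sigma> (K + i) = (ruler N, 0)"
  shows "terminates (compile K d p) \<sigma> (poly (cost p) N) (exec N p \<sigma>)"
  using assms
proof (induction p arbitrary: d \<sigma>)
  case (PWrite k a)
  show ?case unfolding compile.simps exec.simps cost.simps poly_1 by (rule terminates_Write)
next
  case (PMove k e)
  show ?case unfolding compile.simps exec.simps cost.simps poly_1 by (rule terminates_Move)
next
  case (PSeq p q)
  have p: "terminates (compile K d p) \<sigma> (poly (cost p) N) (exec N p \<sigma>)" using PSeq by auto
  have "exec N p \<sigma> (K + i) = (ruler N, 0)" if "d \<le> i" "i < D" for i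
    using exec_unchanged[of K s p "K + i"] PSeq.prems that by simp
  then have "terminates (compile K d q) (exec N p \<sigma>) (poly (cost q) N) (exec N q (exec N p \<sigma>))"
    using PSeq by auto
  from terminates_Seq[OF p this] show ?case by simp
next
  case (PCond k A p q)
  have "terminates (compile K d p) \<sigma> (poly (cost p) N) (exec N p \<sigma>)"
    "terminates (compile K d q) \<sigma> (poly (cost q) N) (exec N q \<sigma>)"
    using PCond by auto
  then have "terminates (if read_tape (\<sigma> k) \<in> A then compile K d p else compile K d q) \<sigma>
      (poly (cost p) N + poly (cost q) N) (exec N (PCond k A p q) \<sigma>)"
    using terminates_mono[OF _ le_add1] terminates_mono[OF _ le_add2] by simp
  from terminates_Cond[OF this] show ?case by simp
next
  case (Repeat p)
  let ?k = "K + d" and ?c = "poly (cost p) N"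
  have d: "d < D" using Repeat.prems(2) by simp
  have rd: "\<sigma> ?k = (ruler N, 0)" using Repeat.prems(3)[of d] d by simp
  \<comment> \<open>\<open>f i\<close> is the store before round \<open>i\<close>, with the ruler
    head on mark \<open>i + 1\<close>; \<open>g i\<close> is the store after all rounds and
    \<open>i\<close> moves on the way back.\<close>
  define f where "f i = ((exec N p ^^ i) \<sigma>)(?k := (ruler N, Suc i))" for i
  define g where "g i = ((exec N p ^^ N) \<sigma>)(?k := (ruler N, Suc N - i))" for i
  have un: "(exec N p ^^ i) \<sigma> j = \<sigma> j" if "K \<le> j" for i j
    using that by (induction i) (use Repeat.prems exec_unchanged[of K s p j] in auto)
  have 1: "terminates (Move ?k Move_Right) \<sigma> 1 (f 0)"
    using terminates_Move[of ?k Move_Right \<sigma>] rd by (simp add: f_def)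
  have "terminates (compile K (Suc d) p) (f i) ?c ((f (Suc i))(?k := (ruler N, Suc i)))" for i
  proof -
    have "terminates (compile K (Suc d) p) (f i) ?c (exec N p (f i))"
      by (rule Repeat.IH) (use Repeat.prems un in \<open>auto simp: f_def\<close>)
    moreover have "exec N p (f i) = (f (Suc i))(?k := (ruler N, Suc i))"
      unfolding f_def using exec_frame[of K s p ?k] Repeat.prems(1) by simp
    ultimately show ?thesis by simp
  qed
  then have body: "terminates (Seq (compile K (Suc d) p) (Move ?k Move_Right)) (f i) (?c + 2) (f (Suc i))" for i
    using terminates_Seq[OF _ terminates_Move[of ?k Move_Right "(f (Suc i))(?k := (ruler N, Suc i))"], of "compile K (Suc d) p" "f i" ?c]
    by (simp add: f_def)
  have 2: "terminates (While ?k {2} (Seq (compile K (Suc d) p) (Move ?k Move_Right))) (f 0)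
      (N * (?c + 2 + 2) + 1) (f N)"
  proof (rule terminates_While_iterate, intro conjI body)
    show "read_tape (f i ?k) \<in> {2}" if "i < N" for i
      using that by (simp add: f_def read_tape_def ruler_def)
    show "read_tape (f N ?k) \<notin> {2}" by (simp add: f_def read_tape_def ruler_def)
  qed
  have left: "terminates (Move ?k Move_Left) (g i) 1 (g (Suc i))" for i
    using terminates_Move[of ?k Move_Left "g i"] by (simp add: g_def)
  have "terminates (While ?k {0, 2} (Move ?k Move_Left)) (g 0) (Suc N * (1 + 2) + 1) (g (Suc N))"
  proof (rule terminates_While_iterate, intro conjI left)
    show "read_tape (g i ?k) \<in> {0, 2}" if "i < Suc N" for i
      using that by (simp add: g_def read_tape_def ruler_def)
    show "read_tape (g (Suc N) ?k) \<notin> {0, 2}" by (simp add: g_def read_tape_def ruler_def)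
  qed
  moreover have "g 0 = f N" by (simp add: f_def g_def)
  \<comment> \<open>The head returns from cell \<open>N + 1\<close>, hence \<open>Suc N\<close>
    moves. By \<open>un\<close> the rounds left the ruler entry alone, so overwriting it with its
    old value is no change.\<close>
  moreover have "g (Suc N) = exec N (Repeat p) \<sigma>"
    using un[of ?k N] rd by (simp add: g_def fun_upd_idem)
  ultimately have 3: "terminates (While ?k {0, 2} (Move ?k Move_Left)) (f N) (Suc N * (1 + 2) + 1) (exec N (Repeat p) \<sigma>)"
    by simp
  from terminates_Seq[OF 1 terminates_Seq[OF 2 3]] show ?case
    by (simp add: terminates_mono algebra_simps)
qed

section \<open>Copying the input length to the rulers\<close>

definition fill_ruler :: "nat \<Rightarrow> code" where
  "fill_ruler j = Seq (Move 0 Move_Right) (Seq (Move j Move_Right)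
     (Seq (While 0 {2, 3} (Seq (Write j 2) (Seq (Move j Move_Right) (Move 0 Move_Right))))
          (While 0 {0, 2, 3} (Seq (Move 0 Move_Left) (Move j Move_Left)))))"

fun fill_rulers :: "nat \<Rightarrow> nat \<Rightarrow> code" where
  "fill_rulers K 0 = Skip"
| "fill_rulers K (Suc D) = Seq (fill_rulers K D) (fill_ruler (K + D))"

definition ruler_store :: "nat \<Rightarrow> nat \<Rightarrow> bool list \<Rightarrow> store" where
  "ruler_store K D x = (\<lambda>i. if K \<le> i \<and> i < K + D then (ruler (length x), 0) else init_store x i)"

text \<open>The tests look for the bit symbols 2 and 3. A bit costs 7 steps on the way out and 5 on
  the way back, whence the factor 12; the constant 20 is generous.\<close>

lemma terminates_fill_ruler:
  assumes "\<sigma> 0 = input_tape x" "\<sigma> j = empty_tape" "j \<noteq> 0"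
  shows "terminates (fill_ruler j) \<sigma> (12 * length x + 20) (\<sigma>(j := (ruler (length x), 0)))"
proof -
  let ?N = "length x" and ?inp = "fst (input_tape x)"
  define f where "f i = \<sigma>(0 := (?inp, Suc i), j := (ruler i, Suc i))" for i
  define g where "g i = \<sigma>(0 := (?inp, Suc ?N - i), j := (ruler ?N, Suc ?N - i))" for i
  have s0: "\<sigma> 0 = (?inp, 0)" using assms(1) by (simp add: input_tape_def)
  have sj: "\<sigma> j = (ruler 0, 0)" using assms(2) by (auto simp: empty_tape_def ruler_def)
  have 1: "terminates (Move 0 Move_Right) \<sigma> 1 (\<sigma>(0 := (?inp, 1)))"
    using terminates_Move[of 0 Move_Right \<sigma>] s0 by simp
  have 2: "terminates (Move j Move_Right) (\<sigma>(0 := (?inp, 1))) 1 (f 0)"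
    using terminates_Move[of j Move_Right "\<sigma>(0 := (?inp, 1))"] sj assms(3) by (simp add: f_def)
  have body: "terminates (Seq (Write j 2) (Seq (Move j Move_Right) (Move 0 Move_Right))) (f i) 5 (f (Suc i))" for i
  proof -
    let ?g = "\<sigma>(0 := (?inp, Suc i), j := (ruler (Suc i), Suc i))"
    let ?h = "\<sigma>(0 := (?inp, Suc i), j := (ruler (Suc i), Suc (Suc i)))"
    have "(ruler i)(Suc i := 2) = ruler (Suc i)" by (auto simp: ruler_def fun_eq_iff)
    then have a: "terminates (Write j 2) (f i) 1 ?g"
      using terminates_Write[of j 2 "f i"] by (simp add: f_def)
    have b: "terminates (Move j Move_Right) ?g 1 ?h"
      using terminates_Move[of j Move_Right ?g] by simp
    have c: "terminates (Move 0 Move_Right) ?h 1 (f (Suc i))"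
      using terminates_Move[of 0 Move_Right ?h] assms(3) by (simp add: f_def fun_upd_twist)
    show ?thesis using terminates_Seq[OF a terminates_Seq[OF b c]] by (simp add: eval_nat_numeral)
  qed
  have 3: "terminates (While 0 {2, 3} (Seq (Write j 2) (Seq (Move j Move_Right) (Move 0 Move_Right))))
      (f 0) (?N * (5 + 2) + 1) (f ?N)"
  proof (rule terminates_While_iterate, intro conjI body)
    show "read_tape (f i 0) \<in> {2, 3}" if "i < ?N" for i
      using that assms(3) by (simp add: f_def read_tape_def input_tape_def bit_sym_def)
    show "read_tape (f ?N 0) \<notin> {2, 3}" using assms(3) by (simp add: f_def read_tape_def input_tape_def)
  qed
  have body': "terminates (Seq (Move 0 Move_Left) (Move j Move_Left)) (g i) 3 (g (Suc i))" for i
  proof -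
    let ?h = "\<sigma>(0 := (?inp, ?N - i), j := (ruler ?N, Suc ?N - i))"
    have a: "terminates (Move 0 Move_Left) (g i) 1 ?h"
      using terminates_Move[of 0 Move_Left "g i"] assms(3) by (simp add: g_def fun_upd_twist)
    have b: "terminates (Move j Move_Left) ?h 1 (g (Suc i))"
      using terminates_Move[of j Move_Left ?h] by (simp add: g_def)
    show ?thesis using terminates_Seq[OF a b] by (simp add: eval_nat_numeral)
  qed
  have "terminates (While 0 {0, 2, 3} (Seq (Move 0 Move_Left) (Move j Move_Left)))
      (g 0) (Suc ?N * (3 + 2) + 1) (g (Suc ?N))"
  proof (rule terminates_While_iterate, intro conjI body')
    show "read_tape (g i 0) \<in> {0, 2, 3}" if "i < Suc ?N" for i
      using that assms(3) by (simp add: g_def read_tape_def input_tape_def bit_sym_def)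
    show "read_tape (g (Suc ?N) 0) \<notin> {0, 2, 3}" using assms(3) by (simp add: g_def read_tape_def input_tape_def)
  qed
  moreover have "g 0 = f ?N" by (simp add: f_def g_def)
  moreover have "g (Suc ?N) = \<sigma>(j := (ruler ?N, 0))"
    using s0 by (auto simp: g_def fun_eq_iff)
  ultimately have 4: "terminates (While 0 {0, 2, 3} (Seq (Move 0 Move_Left) (Move j Move_Left)))
      (f ?N) (Suc ?N * (3 + 2) + 1) (\<sigma>(j := (ruler ?N, 0)))" by simp
  show ?thesis
    unfolding fill_ruler_def
    by (rule terminates_mono[OF terminates_Seq[OF 1 terminates_Seq[OF 2 terminates_Seq[OF 3 4]]]]) simp
qed

lemma terminates_fill_rulers:
  assumes "K \<ge> 1"
  shows "terminates (fill_rulers K D) (init_store x) (D * (12 * length x + 21)) (ruler_store K D x)"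
proof (induction D)
  case 0
  have "ruler_store K 0 x = init_store x" by (auto simp: ruler_store_def fun_eq_iff)
  then show ?case using terminates_Skip by simp
next
  case (Suc D)
  have "terminates (fill_ruler (K + D)) (ruler_store K D x) (12 * length x + 20)
      ((ruler_store K D x)(K + D := (ruler (length x), 0)))"
    by (rule terminates_fill_ruler) (use assms in \<open>auto simp: ruler_store_def init_store_def\<close>)
  moreover have "(ruler_store K D x)(K + D := (ruler (length x), 0)) = ruler_store K (Suc D) x"
    by (auto simp: ruler_store_def fun_eq_iff)
  ultimately have "terminates (fill_rulers K (Suc D)) (init_store x)
      (Suc (D * (12 * length x + 21) + (12 * length x + 20))) (ruler_store K (Suc D) x)"
    unfolding fill_rulers.simps by (metis terminates_Seq[OF Suc])
  then show ?case by (rule terminates_mono) simp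
qed

section \<open>From bounded-loop programs to polynomial-time machines\<close>

definition program :: "nat \<Rightarrow> prog \<Rightarrow> nat \<Rightarrow> nat set \<Rightarrow> code" where
  "program K p k A = Seq (fill_rulers K (height p))
     (Seq (compile K 0 p) (Cond k A (Halt True) (Halt False)))"

lemma code_ok_compile:
  "prog_ok K s p \<Longrightarrow> height p + d \<le> D \<Longrightarrow> 3 \<le> s \<Longrightarrow> code_ok (K + D) s (compile K d p)"
  by (induction p arbitrary: d) auto

lemma code_ok_fill_rulers:
  "D \<le> E \<Longrightarrow> 1 \<le> K \<Longrightarrow> 3 \<le> s \<Longrightarrow> code_ok (K + E) s (fill_rulers K D)"
  by (induction D) (auto simp: fill_ruler_def)

text \<open>The 3 extra steps are those of the two \<open>Seq\<close> and of the final
  \<open>Cond\<close>.\<close>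

lemma program_result:
  assumes "prog_ok K s p" "1 \<le> K" "k < K"
  shows "\<exists>n\<le>height p * (12 * length x + 21) + poly (cost p) (length x) + 3. \<exists>\<sigma>.
    (cfg_step ^^ n) (program K p k A, init_store x) =
      (Halt (read_tape (exec (length x) p (init_store x) k) \<in> A), \<sigma>)"
proof -
  let ?N = "length x" and ?\<sigma> = "ruler_store K (height p) x" and ?D = "height p"
  let ?fin = "Cond k A (Halt True) (Halt False)"
  obtain a where a: "a \<le> Suc (?D * (12 * ?N + 21))"
      "runs a (program K p k A, init_store x) (Seq (compile K 0 p) ?fin, ?\<sigma>)"
    using runs_Seq[OF terminates_fill_rulers[OF assms(2), of ?D x]] unfolding program_def by blast
  have "terminates (compile K 0 p) ?\<sigma> (poly (cost p) ?N) (exec ?N p ?\<sigma>)"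
    by (rule terminates_compile[OF assms(1), where D = ?D]) (auto simp: ruler_store_def)
  then obtain b where b: "b \<le> Suc (poly (cost p) ?N)"
      "runs b (Seq (compile K 0 p) ?fin, ?\<sigma>) (?fin, exec ?N p ?\<sigma>)"
    using runs_Seq by blast
  \<comment> \<open>The rulers lie beyond the first \<open>K\<close> tapes, so they do not influence
    what tape \<open>k\<close> holds.\<close>
  have "exec ?N p ?\<sigma> k = exec ?N p (init_store x) k"
    using exec_cong[OF assms(1), of ?\<sigma> "init_store x" ?N] assms(3) by (simp add: ruler_store_def)
  then have "cfg_step (?fin, exec ?N p ?\<sigma>) =
      (Halt (read_tape (exec ?N p (init_store x) k) \<in> A), exec ?N p ?\<sigma>)"
    by (simp add: cfg_step_def)
  then have "runs (Suc 0) (?fin, exec ?N p ?\<sigma>) (Halt (read_tape (exec ?N p (init_store x) k) \<in> A), exec ?N p ?\<sigma>)"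
    by (intro runs_step) (simp_all add: runs_refl)
  from runs_funpow[OF runs_trans[OF a(2) runs_trans[OF b(2) this]]] a(1) b(1)
  show ?thesis by (intro exI[of _ "a + (b + Suc 0)"]) auto
qed

text \<open>From here on it suffices to write a \<open>prog\<close> whose answer can be read off one
  symbol; the machine and its running time come with it.\<close>

theorem ex_poly_time_tm:
  assumes "prog_ok K s p" "1 \<le> K" "k < K" "4 \<le> s"
  shows "\<exists>M. wf_tm M \<and> poly_time M \<and>
    (\<forall>x. (read_tape (exec (length x) p (init_store x) k) \<in> A \<longrightarrow> accepts M x) \<and>
         (read_tape (exec (length x) p (init_store x) k) \<notin> A \<longrightarrow> rejects M x))"
proof -
  let ?c = "program K p k A" and ?m = "K + height p"
  obtain cs where cs: "set cs = reach ?c" "distinct cs" "cs ! 0 = ?c" using ex_code_list by blast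
  have "code_ok ?m s ?c"
    using code_ok_compile[OF assms(1), of 0 "height p"] code_ok_fill_rulers[of "height p" "height p" K s] assms
    by (simp add: program_def)
  moreover have halts: "Halt True \<in> reach ?c" "Halt False \<in> reach ?c" by (auto simp: program_def)
  ultimately interpret code_machine ?m s ?c cs using cs assms by unfold_locales auto
  let ?b = "\<lambda>x. read_tape (exec (length x) p (init_store x) k) \<in> A"
  define q where "q = [:21 * height p:] + [:0, 12 * height p:] + cost p + [:3:]"
  have *: "\<exists>n\<le>poly q (length x). fst (config_after M x n) = code_index cs (Halt (?b x))" for x
  proof -
    obtain n \<sigma> where n: "n \<le> height p * (12 * length x + 21) + poly (cost p) (length x) + 3"
      "(cfg_step ^^ n) (?c, init_store x) = (Halt (?b x), \<sigma>)"
      using program_result[OF assms(1-3)] by blast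
    then have "n \<le> poly q (length x)" by (simp add: q_def algebra_simps)
    then show ?thesis using simulation[OF n(2)] by auto
  qed
  have acc: "code_index cs (Halt True) = accept_state M" "code_index cs (Halt False) = reject_state M"
    by (simp_all add: code_tm_def)
  have "halted M (config_after M x (poly q (length x)))" for x
  proof -
    obtain n where n: "n \<le> poly q (length x)" "fst (config_after M x n) = code_index cs (Halt (?b x))"
      using * by blast
    then have h: "halted M (config_after M x n)"
      using acc by (cases "?b x") (auto simp: halted_def)
    \<comment> \<open>\<open>poly_time\<close> asks for a halted configuration at exactly the time
      given by the polynomial; once halted, a configuration does not change.\<close>
    have "config_after M x (n + d) = config_after M x n" for d
      using h by (induction d) (auto simp: config_after_def tm_step_def)
    from this[of "poly q (length x) - n"] n(1) h show ?thesis by simp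
  qed
  then have "poly_time M" unfolding poly_time_def by blast
  moreover have "(?b x \<longrightarrow> accepts M x) \<and> (\<not> ?b x \<longrightarrow> rejects M x)" for x
    using *[of x] acc unfolding accepts_def rejects_def by auto
  ultimately show ?thesis using wf_tm by blast
qed

section \<open>Index variables and random access\<close>

text \<open>\<open>prog\<close> has no empty statement, so a stationary move takes its
  place.\<close>

definition skip :: prog where "skip = PMove 11 Stay"

text \<open>The move after the \<open>Repeat\<close> covers a head on cell \<open>N + 1\<close>,
  just past a ruler of full length; at cell 0 a left move has no effect.\<close>

definition rewind :: "nat \<Rightarrow> prog" where
  "rewind k = Repeat (PMove k Move_Left) ;; PMove k Move_Left"

text \<open>
  Tapes 1 to 5 carry \<open>n\<close> marks each; a head on the \<open>i\<close>-th mark represents the index \<open>i\<close>, and the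
  head of an idle tape rests on cell 0.
\<close>

definition loop :: "nat \<Rightarrow> prog \<Rightarrow> prog" where
  "loop k p = PMove k Move_Right ;; Repeat (PCond k {2} (p ;; PMove k Move_Right) skip) ;; rewind k"

text \<open>Reading \<open>x\<close> destroys it; tape 6 keeps a copy from which it is restored.\<close>

definition goto :: "nat \<Rightarrow> nat \<Rightarrow> prog" where
  "goto a x =
     Repeat (PCond x {1} skip (PMove x Move_Left ;; PMove a Move_Right ;; PMove 6 Move_Right)) ;;
     Repeat (PCond 6 {1} skip (PMove 6 Move_Left ;; PMove x Move_Right))"

text \<open>The entry in row \<open>i\<close> and column \<open>j\<close>, counted from 1, is in
  cell \<open>(i - 1) * n + j\<close>. The head of tape 0 starts on cell \<open>j\<close> and jumps
  \<open>n\<close> cells at a time; the head of tape 7 moves left before the test, so there are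
  \<open>i - 1\<close> jumps and it ends on cell 0.\<close>

definition goto_entry :: "nat \<Rightarrow> nat \<Rightarrow> prog" where
  "goto_entry v w = goto 0 w ;; goto 7 v ;;
     Repeat (PMove 7 Move_Left ;; PCond 7 {1} skip (loop 5 (PMove 0 Move_Right)))"

definition if_adj :: "nat \<Rightarrow> nat \<Rightarrow> prog \<Rightarrow> prog \<Rightarrow> prog" where
  "if_adj v w p q = goto_entry v w ;; PCond 0 {3} (rewind 0 ;; p) (rewind 0 ;; q)"

definition if_mark :: "nat \<Rightarrow> nat \<Rightarrow> prog \<Rightarrow> prog \<Rightarrow> prog" where
  "if_mark v a p q = goto 8 v ;; PCond 8 {a} (rewind 8 ;; p) (rewind 8 ;; q)"

definition put_mark :: "nat \<Rightarrow> nat \<Rightarrow> prog" where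
  "put_mark v a = goto 8 v ;; PWrite 8 a ;; rewind 8"

definition append_mark :: "nat \<Rightarrow> prog" where
  "append_mark k = PMove k Move_Right ;; Repeat (PCond k {2} (PMove k Move_Right) skip) ;;
     PWrite k 2 ;; rewind k"

text \<open>The square \<open>n\<^sup>2\<close> of the number of vertices is recognised as the sum \<open>1 + 3 + ... + (2n - 1)\<close>.\<close>

definition setup_step :: prog where
  "setup_step = PCond 0 {2, 3}
     (append_mark 1 ;; append_mark 2 ;; append_mark 3 ;; append_mark 4 ;; append_mark 5 ;;
      loop 5 (PMove 0 Move_Right ;; PMove 0 Move_Right) ;; PMove 0 Move_Left) skip"

definition index_setup :: prog where
  "index_setup = PMove 0 Move_Right ;; Repeat setup_step ;; rewind 0"

section \<open>Effect of the index operations\<close>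

lemma exec_skip [simp]: "exec N skip \<sigma> = \<sigma>"
  by (simp add: skip_def)

lemma exec_rewind:
  assumes "snd (\<sigma> k) \<le> Suc N"
  shows "exec N (rewind k) \<sigma> = \<sigma>(k := (fst (\<sigma> k), 0))"
proof -
  have "(exec N (PMove k Move_Left) ^^ i) \<sigma> = \<sigma>(k := (fst (\<sigma> k), snd (\<sigma> k) - i))" for i
    by (induction i) auto
  then show ?thesis using assms by (simp add: rewind_def)
qed

text \<open>\<open>Repeat\<close> makes all \<open>N\<close> rounds even if the work is done
  earlier. The sequences \<open>f\<close> supplied to it are therefore made stationary, by
  \<open>min\<close> or by truncated subtraction.\<close>

lemma Repeat_iterate:
  assumes "\<And>i. i < N \<Longrightarrow> exec N p (f i) = f (Suc i)"
  shows "exec N (Repeat p) (f 0) = f N"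
proof -
  have "i \<le> N \<Longrightarrow> (exec N p ^^ i) (f 0) = f i" for i
    by (induction i) (use assms in auto)
  then show ?thesis by simp
qed

text \<open>Tape \<open>k\<close> is overwritten in every state, so \<open>g\<close> only has to
  describe the other tapes. Rounds after the \<open>n\<close>-th find a blank under the head and do
  nothing.\<close>

lemma exec_loop:
  assumes "n \<le> N" "\<sigma> = (g 0)(k := (ruler n, 0))"
    and body: "\<And>i. i < n \<Longrightarrow> exec N p ((g i)(k := (ruler n, Suc i))) = (g (Suc i))(k := (ruler n, Suc i))"
  shows "exec N (loop k p) \<sigma> = (g n)(k := (ruler n, 0))"
proof -
  define f where "f i = (g (min i n))(k := (ruler n, Suc (min i n)))" for i
  let ?q = "PCond k {2} (p ;; PMove k Move_Right) skip"
  have "exec N ?q (f i) = f (Suc i)" for i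
  proof (cases "i < n")
    case True
    then have "read_tape (f i k) = 2" by (simp add: f_def read_tape_def ruler_def)
    then show ?thesis using body[OF True] True by (simp add: f_def)
  next
    case False
    then have "read_tape (f i k) = 0" by (simp add: f_def read_tape_def ruler_def)
    then show ?thesis using False by (simp add: f_def)
  qed
  then have "exec N (Repeat ?q) (f 0) = f N" by (rule Repeat_iterate)
  moreover have "exec N (PMove k Move_Right) \<sigma> = f 0" by (simp add: f_def assms(2))
  ultimately have "exec N (loop k p) \<sigma> = exec N (rewind k) (f N)"
    unfolding loop_def exec.simps(3) by simp
  also have "\<dots> = (g n)(k := (ruler n, 0))"
    using assms(1) by (subst exec_rewind) (auto simp: f_def)
  finally show ?thesis .
qed

lemma exec_goto:
  assumes "a \<noteq> x" "a \<noteq> 6" "x \<noteq> 6" "\<sigma> x = (ruler n, i)" "i \<le> N" "\<sigma> 6 = empty_tape" "\<sigma> a = (c, 0)"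
  shows "exec N (goto a x) \<sigma> = \<sigma>(a := (c, i))"
proof -
  define f where "f j = \<sigma>(x := (ruler n, i - j), a := (c, min i j), 6 := (fst empty_tape, min i j))" for j
  define g where "g j = \<sigma>(x := (ruler n, min i j), a := (c, i), 6 := (fst empty_tape, i - j))" for j
  let ?p = "PCond x {1} skip (PMove x Move_Left ;; PMove a Move_Right ;; PMove 6 Move_Right)"
  let ?q = "PCond 6 {1} skip (PMove 6 Move_Left ;; PMove x Move_Right)"
  have "exec N ?p (f j) = f (Suc j)" for j
  proof (cases "j < i")
    case True
    then have "read_tape (f j x) \<noteq> 1" using assms(1-3) by (simp add: f_def read_tape_def ruler_def)
    then show ?thesis using True assms(1-3) by (auto simp: f_def fun_eq_iff)
  next
    case False
    then have "read_tape (f j x) = 1" using assms(1-3) by (simp add: f_def read_tape_def ruler_def)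
    then show ?thesis using False by (auto simp: f_def fun_eq_iff)
  qed
  then have 1: "exec N (Repeat ?p) (f 0) = f N" by (rule Repeat_iterate)
  have "exec N ?q (g j) = g (Suc j)" for j
  proof (cases "j < i")
    case True
    then have "read_tape (g j 6) \<noteq> 1" using assms(1-3) by (simp add: g_def read_tape_def empty_tape_def)
    then show ?thesis using True assms(1-3) by (auto simp: g_def fun_eq_iff)
  next
    case False
    then have "read_tape (g j 6) = 1" using assms(1-3) by (simp add: g_def read_tape_def empty_tape_def)
    then show ?thesis using False by (auto simp: g_def fun_eq_iff)
  qed
  then have 2: "exec N (Repeat ?q) (g 0) = g N" by (rule Repeat_iterate)
  have "\<sigma> = f 0" using assms(1-4,6,7) by (auto simp: f_def fun_eq_iff empty_tape_def)
  moreover have "f N = g 0" using assms(5) by (simp add: f_def g_def min_absorb1)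
  moreover have "g N = \<sigma>(a := (c, i))"
    using assms by (auto simp: g_def fun_eq_iff empty_tape_def)
  ultimately show ?thesis using 1 2 unfolding goto_def exec.simps(3) by metis
qed

lemma exec_loop_right:
  assumes "n \<le> N" "k \<noteq> 0" "\<sigma> k = (ruler n, 0)" "\<sigma> 0 = (c, i)"
  shows "exec N (loop k (PMove 0 Move_Right)) \<sigma> = \<sigma>(0 := (c, i + n))"
proof -
  have "exec N (loop k (PMove 0 Move_Right)) \<sigma> = (\<sigma>(0 := (c, i + n)))(k := (ruler n, 0))"
  proof (rule exec_loop[where g = "\<lambda>j. \<sigma>(0 := (c, i + j))"])
    show "\<sigma> = (\<sigma>(0 := (c, i + 0)))(k := (ruler n, 0))" using assms by (auto simp: fun_eq_iff)
  qed (use assms in \<open>auto simp: fun_eq_iff\<close>)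
  then show ?thesis using assms(2,3) by (auto simp: fun_eq_iff)
qed

lemma exec_loop_right2:
  assumes "n \<le> N" "k \<noteq> 0" "\<sigma> k = (ruler n, 0)" "\<sigma> 0 = (c, i)"
  shows "exec N (loop k (PMove 0 Move_Right ;; PMove 0 Move_Right)) \<sigma> = \<sigma>(0 := (c, i + 2 * n))"
proof -
  have "exec N (loop k (PMove 0 Move_Right ;; PMove 0 Move_Right)) \<sigma> = (\<sigma>(0 := (c, i + 2 * n)))(k := (ruler n, 0))"
  proof (rule exec_loop[where g = "\<lambda>j. \<sigma>(0 := (c, i + 2 * j))"])
    show "\<sigma> = (\<sigma>(0 := (c, i + 2 * 0)))(k := (ruler n, 0))" using assms by (auto simp: fun_eq_iff)
  qed (use assms in \<open>auto simp: fun_eq_iff\<close>)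
  then show ?thesis using assms(2,3) by (auto simp: fun_eq_iff)
qed

lemma exec_goto_entry:
  assumes "n \<le> N" "v \<in> {1..4}" "w \<in> {1..4}" "\<sigma> 0 = (c, 0)" "\<sigma> v = (ruler n, i)" "\<sigma> w = (ruler n, j)"
    "1 \<le> i" "i \<le> n" "j \<le> n" "\<sigma> 5 = (ruler n, 0)" "\<sigma> 6 = empty_tape" "\<sigma> 7 = empty_tape"
  shows "exec N (goto_entry v w) \<sigma> = \<sigma>(0 := (c, (i - 1) * n + j))"
proof -
  have 1: "exec N (goto 0 w) \<sigma> = \<sigma>(0 := (c, j))"
    by (rule exec_goto) (use assms in auto)
  have 2: "exec N (goto 7 v) (\<sigma>(0 := (c, j))) = \<sigma>(0 := (c, j), 7 := (fst empty_tape, i))"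
    by (rule exec_goto) (use assms in \<open>auto simp: empty_tape_def\<close>)
  define f where "f k = \<sigma>(0 := (c, j + min k (i - 1) * n), 7 := (fst empty_tape, i - k))" for k
  let ?p = "PMove 7 Move_Left ;; PCond 7 {1} skip (loop 5 (PMove 0 Move_Right))"
  have "exec N ?p (f k) = f (Suc k)" for k
  proof -
    let ?s = "\<sigma>(0 := (c, j + min k (i - 1) * n), 7 := (fst empty_tape, i - Suc k))"
    have s: "exec N (PMove 7 Move_Left) (f k) = ?s" by (simp add: f_def)
    show ?thesis
    proof (cases "Suc k < i")
      case True
      then have r: "read_tape (?s 7) \<noteq> 1" by (simp add: read_tape_def empty_tape_def)
      have "exec N (loop 5 (PMove 0 Move_Right)) ?s = ?s(0 := (c, j + min k (i - 1) * n + n))"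
        by (rule exec_loop_right) (use assms in auto)
      also have "\<dots> = f (Suc k)" using True by (auto simp: f_def fun_eq_iff)
      finally show ?thesis using s r by simp
    next
      case False
      then have r: "read_tape (?s 7) = 1" by (simp add: read_tape_def empty_tape_def)
      have "?s = f (Suc k)" using False by (auto simp: f_def fun_eq_iff min_def)
      then show ?thesis using s r unfolding exec.simps(3) by simp
    qed
  qed
  then have 3: "exec N (Repeat ?p) (f 0) = f N" by (rule Repeat_iterate)
  have 4: "\<sigma>(0 := (c, j), 7 := (fst empty_tape, i)) = f 0" by (simp add: f_def)
  have "f N = \<sigma>(0 := (c, (i - 1) * n + j))"
    using assms by (auto simp: f_def fun_eq_iff empty_tape_def min_def)
  then show ?thesis unfolding goto_entry_def exec.simps(3) 1 2 4 3 by simp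
qed

lemma exec_append_mark:
  assumes "n < N" "\<sigma> k = (ruler n, 0)"
  shows "exec N (append_mark k) \<sigma> = \<sigma>(k := (ruler (Suc n), 0))"
proof -
  define f where "f i = \<sigma>(k := (ruler n, Suc (min i n)))" for i
  let ?p = "PCond k {2} (PMove k Move_Right) skip"
  have "exec N ?p (f i) = f (Suc i)" for i
    by (cases "i < n") (simp_all add: f_def read_tape_def ruler_def)
  then have 1: "exec N (Repeat ?p) (f 0) = f N" by (rule Repeat_iterate)
  have 2: "exec N (PMove k Move_Right) \<sigma> = f 0" using assms by (simp add: f_def)
  have "(ruler n)(Suc n := 2) = ruler (Suc n)" by (auto simp: ruler_def fun_eq_iff)
  then have 3: "exec N (PWrite k 2) (f N) = \<sigma>(k := (ruler (Suc n), Suc n))"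
    using assms by (simp add: f_def)
  show ?thesis
    unfolding append_mark_def exec.simps(3) 2 1 3 using assms(1) by (subst exec_rewind) auto
qed

section \<open>Memory layout and its initialisation\<close>

record mem =
  arr :: "nat \<Rightarrow> nat"
  flag :: nat
  crit :: nat
  count :: nat

definition mem_store :: "(nat \<Rightarrow> nat) \<Rightarrow> nat \<Rightarrow> (nat \<Rightarrow> nat) \<Rightarrow> mem \<Rightarrow> store" where
  "mem_store inp n ix d = (\<lambda>k.
     if k = 0 then (inp, 0)
     else if k \<le> 4 then (ruler n, ix k)
     else if k = 5 then (ruler n, 0)
     else if k = 8 then (arr d, 0)
     else if k = 9 then ((fst empty_tape)(0 := flag d), 0)
     else if k = 10 then ((fst empty_tape)(0 := crit d), 0)
     else if k = 11 then (fst empty_tape, count d)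
     else empty_tape)"

text \<open>The two flags are 1 because cell 0 of a fresh tape holds the start marker.\<close>

definition init_mem :: mem where
  "init_mem = \<lparr>arr = fst empty_tape, flag = 1, crit = 1, count = 0\<rparr>"

text \<open>Tape 5 already has its \<open>k + 1\<close> marks when it drives the loop, so the head
  of tape 0 advances by \<open>2 * (k + 1) - 1\<close> cells, from \<open>k * k + 1\<close> to
  \<open>(k + 1) * (k + 1) + 1\<close>.\<close>

lemma exec_setup_step:
  assumes "k < n" "n * n = length x" "\<sigma> 0 = (fst (input_tape x), Suc (k * k))"
    "\<And>i. 1 \<le> i \<Longrightarrow> i \<le> 5 \<Longrightarrow> \<sigma> i = (ruler k, 0)"
  shows "exec (length x) setup_step \<sigma> = (\<lambda>i.
    if i = 0 then (fst (input_tape x), Suc (Suc k * Suc k)) else if i \<le> 5 then (ruler (Suc k), 0) else \<sigma> i)"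
proof -
  let ?N = "length x" and ?R = "(ruler (Suc k), 0)"
  have kk: "Suc k * Suc k \<le> ?N" using assms(1,2) mult_le_mono[of "Suc k" n "Suc k" n] by simp
  then have kN: "k < ?N" "Suc k \<le> ?N" by (simp_all add: algebra_simps)
  have A: "exec ?N (append_mark j) \<tau> = \<tau>(j := ?R)" if "\<tau> j = (ruler k, 0)" for \<tau> j
    using exec_append_mark[of k ?N \<tau> j] kN(1) that by simp
  let ?s1 = "\<sigma>(1 := ?R)"
  let ?s2 = "?s1(2 := ?R)"
  let ?s3 = "?s2(3 := ?R)"
  let ?s4 = "?s3(4 := ?R)"
  let ?s5 = "?s4(5 := ?R)"
  have 1: "exec ?N (append_mark 1) \<sigma> = ?s1" by (rule A) (use assms(4) in simp)
  have 2: "exec ?N (append_mark 2) ?s1 = ?s2" by (rule A) (use assms(4) in simp)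
  have 3: "exec ?N (append_mark 3) ?s2 = ?s3" by (rule A) (use assms(4) in simp)
  have 4: "exec ?N (append_mark 4) ?s3 = ?s4" by (rule A) (use assms(4) in simp)
  have 5: "exec ?N (append_mark 5) ?s4 = ?s5" by (rule A) (use assms(4) in simp)
  have 6: "exec ?N (loop 5 (PMove 0 Move_Right ;; PMove 0 Move_Right)) ?s5 =
      ?s5(0 := (fst (input_tape x), Suc (k * k) + 2 * Suc k))"
    by (rule exec_loop_right2[OF kN(2)]) (use assms(3) in simp_all)
  have "read_tape (\<sigma> 0) \<in> {2, 3}"
    using assms(3) kk by (simp add: read_tape_def input_tape_def bit_sym_def algebra_simps)
  then have "exec ?N setup_step \<sigma> =
      exec ?N (PMove 0 Move_Left) (?s5(0 := (fst (input_tape x), Suc (k * k) + 2 * Suc k)))"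
    unfolding setup_step_def exec.simps(3,4) 1 2 3 4 5 6 by (rule if_P)
  also have "Suc (k * k) + 2 * Suc k = Suc (Suc (Suc k * Suc k))" by simp
  also have "exec ?N (PMove 0 Move_Left) (?s5(0 := (fst (input_tape x), Suc (Suc (Suc k * Suc k))))) =
      ?s5(0 := (fst (input_tape x), Suc (Suc k * Suc k)))"
    by (simp del: mult_Suc mult_Suc_right)
  also have "\<dots> = (\<lambda>i. if i = 0 then (fst (input_tape x), Suc (Suc k * Suc k))
      else if i \<le> 5 then ?R else \<sigma> i)"
    by (rule ext) (auto simp: numeral_eq_Suc le_Suc_eq)
  finally show ?thesis .
qed

lemma exec_index_setup:
  assumes "1 \<le> n" "n * n = length x"
  shows "exec (length x) index_setup (init_store x) = mem_store (fst (input_tape x)) n (\<lambda>_. 0) init_mem"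
proof -
  let ?N = "length x" and ?inp = "fst (input_tape x)"
  define f :: "nat \<Rightarrow> store" where "f k = (\<lambda>i. if i = 0 then (?inp, Suc (min k n * min k n))
    else if i \<le> 5 then (ruler (min k n), 0) else empty_tape)" for k
  have e: "empty_tape = (ruler 0, 0)" by (auto simp: empty_tape_def ruler_def)
  have nN: "n \<le> ?N" using assms by (metis mult_le_mono1 nat_mult_1)
  have "exec ?N setup_step (f k) = f (Suc k)" for k
  proof (cases "k < n")
    case True
    have "exec ?N setup_step (f k) = (\<lambda>i. if i = 0 then (?inp, Suc (Suc k * Suc k))
        else if i \<le> 5 then (ruler (Suc k), 0) else f k i)"
      by (rule exec_setup_step[OF True assms(2)]) (use True in \<open>simp_all add: f_def\<close>)
    also have "\<dots> = f (Suc k)" using True by (auto simp: f_def fun_eq_iff)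
    finally show ?thesis .
  next
    case False
    \<comment> \<open>The head is on the first blank after the \<open>n * n\<close> input bits, so
      the remaining rounds are idle.\<close>
    then have "read_tape (f k 0) = 0"
      using assms(2) by (simp add: f_def read_tape_def input_tape_def min_def)
    moreover have "f (Suc k) = f k" using False by (auto simp: f_def fun_eq_iff)
    ultimately show ?thesis by (simp add: setup_step_def)
  qed
  then have 1: "exec ?N (Repeat setup_step) (f 0) = f ?N" by (rule Repeat_iterate)
  have 2: "exec ?N (PMove 0 Move_Right) (init_store x) = f 0"
    by (auto simp: f_def fun_eq_iff init_store_def input_tape_def e)
  have "exec ?N (rewind 0) (f ?N) = (f ?N)(0 := (?inp, 0))"
    using assms nN by (subst exec_rewind) (auto simp: f_def min_def)
  also have "\<dots> = mem_store ?inp n (\<lambda>_. 0) init_mem"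
    using nN by (auto simp: f_def mem_store_def init_mem_def fun_eq_iff min_def empty_tape_def)
  finally show ?thesis unfolding index_setup_def exec.simps(3) 1 2 .
qed

section \<open>The decision procedure\<close>

text \<open>
  The loops over the vertex \<open>u\<close> under test, over the first vertex of a class, over the
  further vertices of the class and over their neighbours use tapes 1 to 4. The array on tape 8
  holds 0 for an uncoloured vertex, 2 in the current class, 3 in an earlier class (or for \<open>u\<close>),
  and 4 if a neighbour excludes the vertex from the current class. Cell 0 of tape 9 holds 3
  if \<open>u\<close> has a neighbour in the current class, cell 0 of tape 10 holds 3 if this was so for all
  classes, and 2 stands for false; the head of tape 11 counts the critical vertices.
\<close>

definition add_prog :: "nat \<Rightarrow> prog" where
  "add_prog v = put_mark v 2 ;; loop 4 (if_adj v 4 (if_mark 4 0 (put_mark 4 4) skip) skip) ;;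
     if_adj 1 v (PWrite 9 3) skip"

definition class_prog :: prog where
  "class_prog = PWrite 9 2 ;; add_prog 2 ;; loop 3 (if_mark 3 0 (add_prog 3) skip) ;;
     loop 3 (if_mark 3 2 (put_mark 3 3) (if_mark 3 4 (put_mark 3 0) skip)) ;;
     PCond 9 {2} (PWrite 10 2) skip"

definition test_prog :: prog where
  "test_prog = PWrite 10 3 ;; loop 3 (put_mark 3 0) ;; put_mark 1 3 ;;
     loop 2 (if_mark 2 0 class_prog skip) ;; PCond 10 {3} (PMove 11 Move_Right) skip"

text \<open>With \<open>c\<close> critical vertices the head of tape 11 stops on cell
  \<open>c - 1\<close>, truncated at 0, and reads the start marker exactly if
  \<open>c \<le> 1\<close>.\<close>

definition stability_prog :: prog where
  "stability_prog = index_setup ;; loop 1 test_prog ;; PMove 11 Move_Left"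

definition put :: "nat \<Rightarrow> nat \<Rightarrow> mem \<Rightarrow> mem" where
  "put i a d = d\<lparr>arr := (arr d)(i := a)\<rparr>"

section \<open>The procedure as functions on an abstract memory\<close>

locale adjacency =
  fixes inp :: "nat \<Rightarrow> nat" and n N :: nat
  assumes n: "1 \<le> n" "n * n = N"
begin

lemma n_le_N: "n \<le> N"
  using n by (metis mult_le_mono1 nat_mult_1)

definition adj :: "nat \<Rightarrow> nat \<Rightarrow> bool" where
  "adj i j \<longleftrightarrow> inp ((i - 1) * n + j) = 3"

definition for_all :: "(nat \<Rightarrow> mem \<Rightarrow> mem) \<Rightarrow> mem \<Rightarrow> mem" where
  "for_all f = fold f [1..<Suc n]"

definition add :: "nat \<Rightarrow> nat \<Rightarrow> mem \<Rightarrow> mem" where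
  "add u v d =
     (let d = for_all (\<lambda>w d. if adj v w then if arr d w = 0 then put w 4 d else d else d) (put v 2 d)
      in if adj u v then d\<lparr>flag := 3\<rparr> else d)"

definition greedy_class :: "nat \<Rightarrow> nat \<Rightarrow> mem \<Rightarrow> mem" where
  "greedy_class u r d =
     (let d = for_all (\<lambda>v d. if arr d v = 0 then add u v d else d) (add u r (d\<lparr>flag := 2\<rparr>));
          d = for_all (\<lambda>v d. if arr d v = 2 then put v 3 d else if arr d v = 4 then put v 0 d else d) d
      in if flag d = 2 then d\<lparr>crit := 2\<rparr> else d)"

definition test :: "nat \<Rightarrow> mem \<Rightarrow> mem" where
  "test u d =
     (let d = for_all (\<lambda>r d. if arr d r = 0 then greedy_class u r d else d)
                (put u 3 (for_all (\<lambda>v. put v 0) (d\<lparr>crit := 3\<rparr>)))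
      in if crit d = 3 then d\<lparr>count := Suc (count d)\<rparr> else d)"

abbreviation S :: "(nat \<Rightarrow> nat) \<Rightarrow> mem \<Rightarrow> store" where
  "S \<equiv> mem_store inp n"

lemma S_upd:
  "(S ix d)(0 := (inp, 0)) = S ix d"
  "(S ix d)(8 := (a, 0)) = S ix (d\<lparr>arr := a\<rparr>)"
  by (auto simp: mem_store_def fun_eq_iff)

lemma exec_if_adj:
  assumes "v \<in> {1..4}" "w \<in> {1..4}" "1 \<le> ix v" "ix v \<le> n" "1 \<le> ix w" "ix w \<le> n"
  shows "exec N (if_adj v w p q) (S ix d) =
    (if adj (ix v) (ix w) then exec N p (S ix d) else exec N q (S ix d))"
proof -
  let ?i = "(ix v - 1) * n + ix w"
  have 1: "exec N (goto_entry v w) (S ix d) = (S ix d)(0 := (inp, ?i))"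
    by (rule exec_goto_entry[OF n_le_N assms(1,2)]) (use assms in \<open>auto simp: mem_store_def\<close>)
  have "?i \<le> (n - 1) * n + n" using assms by (intro add_mono mult_le_mono) auto
  also have "\<dots> = N" using n by (cases n) auto
  finally have "exec N (rewind 0) ((S ix d)(0 := (inp, ?i))) = S ix d"
    by (subst exec_rewind) (auto simp: S_upd)
  then show ?thesis
    unfolding if_adj_def exec.simps(3,4) 1 by (simp add: adj_def read_tape_def)
qed

lemma exec_goto_array:
  assumes "v \<in> {1..4}" "ix v \<le> n"
  shows "exec N (goto 8 v) (S ix d) = (S ix d)(8 := (arr d, ix v))"
  by (rule exec_goto[where n = n and \<sigma> = "S ix d" and x = v])
    (use assms n_le_N in \<open>auto simp: mem_store_def\<close>)

lemma exec_if_mark: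
  assumes "v \<in> {1..4}" "ix v \<le> n"
  shows "exec N (if_mark v a p q) (S ix d) =
    (if arr d (ix v) = a then exec N p (S ix d) else exec N q (S ix d))"
proof -
  have "(S ix d)(8 := (arr d, 0)) = S ix d" by (simp add: S_upd)
  then have "exec N (rewind 8) ((S ix d)(8 := (arr d, ix v))) = S ix d"
    using assms n_le_N by (subst exec_rewind) auto
  then show ?thesis
    unfolding if_mark_def exec.simps(3,4) exec_goto_array[where ix = ix, OF assms] by (simp add: read_tape_def)
qed

lemma exec_put_mark:
  assumes "v \<in> {1..4}" "ix v \<le> n"
  shows "exec N (put_mark v a) (S ix d) = S ix (put (ix v) a d)"
proof -
  have "exec N (rewind 8) ((S ix d)(8 := ((arr d)(ix v := a), ix v))) = S ix (put (ix v) a d)"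
    using assms n_le_N by (subst exec_rewind) (auto simp: S_upd put_def)
  then show ?thesis
    unfolding put_mark_def exec.simps(3) exec_goto_array[where ix = ix, OF assms] by simp
qed

text \<open>A program loop becomes a \<open>fold\<close>, since placing the head of tape
  \<open>k\<close> on mark \<open>i\<close> amounts to setting \<open>ix k\<close> to
  \<open>i\<close>. The index is 0 before and after, which is what enclosing loops rely on.\<close>

lemma exec_for_all:
  assumes "k \<in> {1..4}" "ix k = 0"
    and body: "\<And>i d. 1 \<le> i \<Longrightarrow> i \<le> n \<Longrightarrow> exec N p (S (ix(k := i)) d) = S (ix(k := i)) (f i d)"
  shows "exec N (loop k p) (S ix d) = S ix (for_all f d)"
proof -
  have upd: "(S ix e)(k := (ruler n, i)) = S (ix(k := i)) e" for e i
    using assms(1) by (auto simp: mem_store_def fun_eq_iff)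
  have ix: "ix(k := 0) = ix" using assms(2) by auto
  have "exec N (loop k p) (S ix d) = (S ix (fold f [1..<Suc n] d))(k := (ruler n, 0))"
  proof (rule exec_loop[where g = "\<lambda>i. S ix (fold f [1..<Suc i] d)"])
    show "n \<le> N" by (rule n_le_N)
    show "S ix d = (S ix (fold f [1..<Suc 0] d))(k := (ruler n, 0))"
      unfolding upd ix by simp
    show "exec N p ((S ix (fold f [1..<Suc i] d))(k := (ruler n, Suc i))) =
        (S ix (fold f [1..<Suc (Suc i)] d))(k := (ruler n, Suc i))" if "i < n" for i
      unfolding upd using body[of "Suc i" "fold f [1..<Suc i] d"] that by simp
  qed
  then show ?thesis unfolding upd ix for_all_def .
qed

lemma exec_flags:
  "exec N (PWrite 9 a) (S ix d) = S ix (d\<lparr>flag := a\<rparr>)"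
  "exec N (PWrite 10 a) (S ix d) = S ix (d\<lparr>crit := a\<rparr>)"
  "exec N (PMove 11 Move_Right) (S ix d) = S ix (d\<lparr>count := Suc (count d)\<rparr>)"
  "exec N (PCond 9 {a} p q) (S ix d) = (if flag d = a then exec N p (S ix d) else exec N q (S ix d))"
  "exec N (PCond 10 {a} p q) (S ix d) = (if crit d = a then exec N p (S ix d) else exec N q (S ix d))"
  by (auto simp: mem_store_def fun_eq_iff read_tape_def)

lemma exec_add:
  assumes "v \<in> {2..3}" "1 \<le> ix v" "ix v \<le> n" "1 \<le> ix 1" "ix 1 \<le> n" "ix 4 = 0"
  shows "exec N (add_prog v) (S ix d) = S ix (add (ix 1) (ix v) d)"
proof -
  let ?f = "\<lambda>w d. if adj (ix v) w then if arr d w = 0 then put w 4 d else d else d"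
  have 1: "exec N (put_mark v 2) (S ix d) = S ix (put (ix v) 2 d)"
    using assms by (simp add: exec_put_mark)
  have 2: "exec N (loop 4 (if_adj v 4 (if_mark 4 0 (put_mark 4 4) skip) skip)) (S ix d) = S ix (for_all ?f d)" for d
    by (rule exec_for_all) (use assms in \<open>auto simp: exec_if_adj exec_if_mark exec_put_mark\<close>)
  have 3: "exec N (if_adj 1 v (PWrite 9 3) skip) (S ix d) =
      S ix (if adj (ix 1) (ix v) then d\<lparr>flag := 3\<rparr> else d)" for d
    using assms by (subst exec_if_adj) (simp_all add: exec_flags del: exec.simps)
  show ?thesis unfolding add_prog_def exec.simps(3) 1 2 3 add_def Let_def by (rule refl)
qed

lemma exec_class:
  assumes "1 \<le> ix 1" "ix 1 \<le> n" "1 \<le> ix 2" "ix 2 \<le> n" "ix 3 = 0" "ix 4 = 0"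
  shows "exec N class_prog (S ix d) = S ix (greedy_class (ix 1) (ix 2) d)"
proof -
  let ?f = "\<lambda>v d. if arr d v = 0 then add (ix 1) v d else d"
  let ?g = "\<lambda>v d. if arr d v = 2 then put v 3 d else if arr d v = 4 then put v 0 d else d"
  have 1: "exec N (add_prog 2) (S ix d) = S ix (add (ix 1) (ix 2) d)" for d
    using assms by (simp add: exec_add)
  have 2: "exec N (loop 3 (if_mark 3 0 (add_prog 3) skip)) (S ix d) = S ix (for_all ?f d)" for d
    by (rule exec_for_all) (use assms in \<open>auto simp: exec_if_mark exec_add\<close>)
  have 3: "exec N (loop 3 (if_mark 3 2 (put_mark 3 3) (if_mark 3 4 (put_mark 3 0) skip))) (S ix d) =
      S ix (for_all ?g d)" for d
    by (rule exec_for_all) (use assms in \<open>auto simp: exec_if_mark exec_put_mark\<close>)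
  have 4: "exec N (PCond 9 {2} (PWrite 10 2) skip) (S ix d) =
      S ix (if flag d = 2 then d\<lparr>crit := 2\<rparr> else d)" for d
    by (simp add: exec_flags del: exec.simps)
  show ?thesis
    unfolding class_prog_def exec.simps(3) exec_flags(1) 1 2 3 4 greedy_class_def Let_def by (rule refl)
qed

lemma exec_test:
  assumes "1 \<le> ix 1" "ix 1 \<le> n" "ix 2 = 0" "ix 3 = 0" "ix 4 = 0"
  shows "exec N test_prog (S ix d) = S ix (test (ix 1) d)"
proof -
  let ?f = "\<lambda>r d. if arr d r = 0 then greedy_class (ix 1) r d else d"
  have 1: "exec N (loop 3 (put_mark 3 0)) (S ix d) = S ix (for_all (\<lambda>v. put v 0) d)" for d
    by (rule exec_for_all) (use assms in \<open>auto simp: exec_put_mark\<close>)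
  have 2: "exec N (put_mark 1 3) (S ix d) = S ix (put (ix 1) 3 d)" for d
    using assms by (simp add: exec_put_mark)
  have 3: "exec N (loop 2 (if_mark 2 0 class_prog skip)) (S ix d) = S ix (for_all ?f d)" for d
    by (rule exec_for_all) (use assms in \<open>auto simp: exec_if_mark exec_class\<close>)
  have 4: "exec N (PCond 10 {3} (PMove 11 Move_Right) skip) (S ix d) =
      S ix (if crit d = 3 then d\<lparr>count := Suc (count d)\<rparr> else d)" for d
    by (simp add: exec_flags del: exec.simps)
  show ?thesis
    unfolding test_prog_def exec.simps(3) exec_flags(2) 1 2 3 4 test_def Let_def by (rule refl)
qed

lemma exec_all_tests:
  "exec N (loop 1 test_prog) (S (\<lambda>_. 0) d) = S (\<lambda>_. 0) (for_all test d)"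
  by (rule exec_for_all) (auto simp: exec_test)

end

section \<open>Correctness of the procedure on co-graphs\<close>

lemma fold_invariant_upto:
  assumes "P 0 d" "\<And>i d. i < n \<Longrightarrow> P i d \<Longrightarrow> P (Suc i) (f (Suc i) d)"
  shows "P n (fold f [1..<Suc n] d)"
proof -
  have "i \<le> n \<Longrightarrow> P i (fold f [1..<Suc i] d)" for i
    by (induction i) (use assms in auto)
  then show ?thesis by simp
qed

locale cograph_input = adjacency inp n N for inp :: "nat \<Rightarrow> nat" and n N :: nat +
  fixes G :: "'v graph" and vertex :: "nat \<Rightarrow> 'v"
  assumes cograph: "cograph G"
    and bij: "bij_betw vertex {1..n} (verts G)"
    and adj_iff: "\<And>i j. i \<in> {1..n} \<Longrightarrow> j \<in> {1..n} \<Longrightarrow> adj i j \<longleftrightarrow> {vertex i, vertex j} \<in> edges G"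
begin

lemma adj_sym: "i \<in> {1..n} \<Longrightarrow> j \<in> {1..n} \<Longrightarrow> adj i j \<Longrightarrow> adj j i"
  using adj_iff by (simp add: insert_commute)

lemma not_adj_self: "i \<in> {1..n} \<Longrightarrow> \<not> adj i i"
  using adj_iff[of i i] simple_edgeD(3)[OF cograph_simple_graph[OF cograph], of "vertex i" "vertex i"]
  by blast

text \<open>The round for \<open>w\<close> changes no mark but that of \<open>w\<close>, so the loop
  amounts to one simultaneous update in terms of the old marks.\<close>

lemma add_eq:
  "add u v d = d\<lparr>arr := (\<lambda>w. if w = v then 2 else if w \<in> {1..n} \<and> adj v w \<and> arr d w = 0 then 4 else arr d w),
     flag := (if adj u v then 3 else flag d)\<rparr>"
proof -
  let ?f = "\<lambda>w d. if adj v w then if arr d w = 0 then put w 4 d else d else d"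
  let ?P = "\<lambda>i e. e = d\<lparr>arr := (\<lambda>w. if w = v then 2 else if w \<in> {1..i} \<and> adj v w \<and> arr d w = 0 then 4 else arr d w)\<rparr>"
  have "?P n (for_all ?f (put v 2 d))"
    unfolding for_all_def
  proof (rule fold_invariant_upto[where P = ?P])
    show "?P 0 (put v 2 d)"
      by (rule mem.equality) (auto simp: put_def fun_eq_iff)
    fix i e assume e: "?P i e"
    show "?P (Suc i) (?f (Suc i) e)"
      by (rule mem.equality) (use e in \<open>auto simp: put_def fun_eq_iff le_Suc_eq\<close>)
  qed
  then show ?thesis unfolding add_def Let_def by simp
qed

definition marked :: "nat \<Rightarrow> mem \<Rightarrow> nat set" where
  "marked a d = {i \<in> {1..n}. arr d i = a}"

text \<open>
  While a class is built from the set \<open>R\<close> of uncoloured vertices, a vertex of \<open>R\<close> is marked 0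
  as long as it could still be added to the class.
\<close>

definition class_inv :: "nat \<Rightarrow> nat set \<Rightarrow> mem \<Rightarrow> mem \<Rightarrow> bool" where
  "class_inv u R d0 d \<longleftrightarrow> crit d = crit d0 \<and> count d = count d0 \<and>
     (\<forall>i\<in>{1..n} - R. arr d i = 3) \<and>
     (\<forall>i\<in>R. arr d i \<in> {0, 2, 4}) \<and>
     (\<forall>i\<in>marked 2 d. \<forall>j\<in>marked 2 d. \<not> adj i j) \<and>
     (\<forall>i\<in>marked 0 d. \<forall>j\<in>marked 2 d. \<not> adj i j) \<and>
     (\<forall>i\<in>marked 4 d. \<exists>j\<in>marked 2 d. adj i j) \<and>
     flag d = (if \<exists>j\<in>marked 2 d. adj u j then 3 else 2)"

text \<open>Mark 0 means that \<open>v\<close> has no neighbour in the class, so the class stays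
  independent; and \<open>v\<close> itself is the neighbour required of every vertex that turns from
  0 to 4.\<close>

lemma class_inv_add:
  assumes inv: "class_inv u R d0 d" and R: "R \<subseteq> {1..n}" and v: "v \<in> {1..n}" "arr d v = 0"
  shows "class_inv u R d0 (add u v d)"
proof -
  let ?d = "add u v d"
  have arr: "arr ?d w = (if w = v then 2 else if w \<in> {1..n} \<and> adj v w \<and> arr d w = 0 then 4 else arr d w)" for w
    by (simp add: add_eq)
  have m2: "marked 2 ?d = insert v (marked 2 d)" using v by (auto simp: marked_def arr)
  have m0: "marked 0 ?d = {w \<in> marked 0 d. w \<noteq> v \<and> \<not> adj v w}" by (auto simp: marked_def arr)
  have m4: "marked 4 ?d = marked 4 d \<union> {w \<in> marked 0 d. w \<noteq> v \<and> adj v w}"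
    using v by (auto simp: marked_def arr)
  have vR: "v \<in> R" using inv v unfolding class_inv_def by (metis DiffI zero_neq_numeral)
  have v0: "v \<in> marked 0 d" using v by (simp add: marked_def)
  have sub: "i \<in> {1..n}" if "i \<in> marked a d" for i a using that by (simp add: marked_def)
  note i = inv[unfolded class_inv_def]
  have v2: "\<not> adj v j" "\<not> adj j v" if "j \<in> marked 2 d" for j
    using i v0 that adj_sym[of j v] sub[OF that] v(1) by blast+
  show ?thesis
    unfolding class_inv_def m2 m0 m4
  proof (intro conjI)
    show "crit ?d = crit d0" "count ?d = count d0" using i by (simp_all add: add_eq)
    show "\<forall>i\<in>{1..n} - R. arr ?d i = 3" using i vR by (auto simp: arr)
    show "\<forall>i\<in>R. arr ?d i \<in> {0, 2, 4}" using i by (auto simp: arr)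
    show "\<forall>i\<in>insert v (marked 2 d). \<forall>j\<in>insert v (marked 2 d). \<not> adj i j"
      using i v2 not_adj_self[OF v(1)] by blast
    show "\<forall>i\<in>{w \<in> marked 0 d. w \<noteq> v \<and> \<not> adj v w}. \<forall>j\<in>insert v (marked 2 d). \<not> adj i j"
      using i adj_sym[OF _ v(1)] sub by blast
    show "\<forall>i\<in>marked 4 d \<union> {w \<in> marked 0 d. w \<noteq> v \<and> adj v w}. \<exists>j\<in>insert v (marked 2 d). adj i j"
      using i adj_sym[OF v(1)] sub by blast
    show "flag ?d = (if \<exists>j\<in>insert v (marked 2 d). adj u j then 3 else 2)"
      using i by (auto simp: add_eq)
  qed
qed

text \<open>No mark turns to 0 during the pass, so at its end every vertex of \<open>R\<close> has
  been added or excluded, and the class is maximal.\<close>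

lemma class_loop:
  assumes "class_inv u R d0 d" "R \<subseteq> {1..n}"
  defines "d' \<equiv> for_all (\<lambda>v d. if arr d v = 0 then add u v d else d) d"
  shows "class_inv u R d0 d'" "marked 0 d' = {}" "marked 2 d \<subseteq> marked 2 d'"
proof -
  let ?f = "\<lambda>v d. if arr d v = 0 then add u v d else d"
  let ?P = "\<lambda>i e. class_inv u R d0 e \<and> (\<forall>j\<in>{1..i}. arr e j \<noteq> 0) \<and> marked 2 d \<subseteq> marked 2 e"
  have "?P n d'"
    unfolding d'_def for_all_def
  proof (rule fold_invariant_upto[where P = ?P])
    show "?P 0 d" using assms(1) by simp
    fix i e assume i: "i < n" and P: "?P i e"
    show "?P (Suc i) (?f (Suc i) e)"
    proof (cases "arr e (Suc i) = 0")
      case True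
      have "class_inv u R d0 (add u (Suc i) e)"
        using class_inv_add[OF _ assms(2)] P True i by simp
      moreover have "\<forall>j\<in>{1..Suc i}. arr (add u (Suc i) e) j \<noteq> 0"
        using P by (auto simp: add_eq le_Suc_eq)
      moreover have "marked 2 e \<subseteq> marked 2 (add u (Suc i) e)" by (auto simp: add_eq marked_def)
      ultimately show ?thesis using P True by auto
    next
      case False
      then show ?thesis using P by (auto simp: le_Suc_eq)
    qed
  qed
  then show "class_inv u R d0 d'" "marked 0 d' = {}" "marked 2 d \<subseteq> marked 2 d'"
    by (auto simp: marked_def)
qed

lemma clean_loop:
  "for_all (\<lambda>v d. if arr d v = 2 then put v 3 d else if arr d v = 4 then put v 0 d else d) d =
    d\<lparr>arr := (\<lambda>w. if w \<in> {1..n} \<and> arr d w = 2 then 3 else if w \<in> {1..n} \<and> arr d w = 4 then 0 else arr d w)\<rparr>"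
proof -
  let ?f = "\<lambda>v d. if arr d v = 2 then put v 3 d else if arr d v = 4 then put v 0 d else d"
  let ?P = "\<lambda>i e. e = d\<lparr>arr := (\<lambda>w. if w \<in> {1..i} \<and> arr d w = 2 then 3
    else if w \<in> {1..i} \<and> arr d w = 4 then 0 else arr d w)\<rparr>"
  have "?P n (for_all ?f d)"
    unfolding for_all_def
  proof (rule fold_invariant_upto[where P = ?P])
    show "?P 0 d" by (rule mem.equality) (auto simp: fun_eq_iff)
    fix i e assume e: "?P i e"
    show "?P (Suc i) (?f (Suc i) e)"
      by (rule mem.equality) (use e in \<open>auto simp: put_def fun_eq_iff le_Suc_eq\<close>)
  qed
  then show ?thesis .
qed

text \<open>\<open>C\<close> is the set marked 2 at the end of the pass. No mark 0 is left then, so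
  the rest of \<open>R\<close> is marked 4 and has neighbours in \<open>C\<close>; cleaning up turns
  4 back into 0 and 2 into 3.\<close>

lemma greedy_class:
  assumes R: "R = marked 0 d" and A: "\<forall>i\<in>{1..n}. arr d i \<in> {0, 3}" and r: "r \<in> R"
  obtains C where "r \<in> C" "C \<subseteq> R" "\<And>i j. i \<in> C \<Longrightarrow> j \<in> C \<Longrightarrow> \<not> adj i j"
    "\<And>i. i \<in> R - C \<Longrightarrow> \<exists>j\<in>C. adj i j" "marked 0 (greedy_class u r d) = R - C"
    "\<forall>i\<in>{1..n}. arr (greedy_class u r d) i \<in> {0, 3}" "count (greedy_class u r d) = count d"
    "crit (greedy_class u r d) = (if \<exists>j\<in>C. adj u j then crit d else 2)"
proof -
  have R': "R \<subseteq> {1..n}" using R by (auto simp: marked_def)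
  define d1 where "d1 = add u r (d\<lparr>flag := 2\<rparr>)"
  define d2 where "d2 = for_all (\<lambda>v d. if arr d v = 0 then add u v d else d) d1"
  define d3 where "d3 = for_all (\<lambda>v d. if arr d v = 2 then put v 3 d else if arr d v = 4 then put v 0 d else d) d2"
  define C where "C = marked 2 d2"
  have g: "greedy_class u r d = (if flag d3 = 2 then d3\<lparr>crit := 2\<rparr> else d3)"
    by (simp add: greedy_class_def d1_def d2_def d3_def Let_def)
  \<comment> \<open>Between classes only the marks 0 and 3 occur, so the invariant holds initially
    with an empty class.\<close>
  have "marked a (d\<lparr>flag := 2\<rparr>) = {}" if "a \<noteq> 0" "a \<noteq> 3" for a
    using A that unfolding marked_def by fastforce
  then have m: "marked 2 (d\<lparr>flag := 2\<rparr>) = {}" "marked 4 (d\<lparr>flag := 2\<rparr>) = {}" by simp_all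
  have "class_inv u R d (d\<lparr>flag := 2\<rparr>)"
    unfolding class_inv_def m using A by (auto simp: R marked_def)
  then have "class_inv u R d d1"
    unfolding d1_def by (rule class_inv_add[OF _ R']) (use r R in \<open>auto simp: marked_def\<close>)
  from class_loop[OF this R'] have
    inv: "class_inv u R d d2" and m0: "marked 0 d2 = {}" and sub: "marked 2 d1 \<subseteq> C"
    unfolding d2_def C_def by blast+
  note i = inv[unfolded class_inv_def]
  have arr3: "arr d3 w = (if w \<in> {1..n} \<and> arr d2 w = 2 then 3 else if w \<in> {1..n} \<and> arr d2 w = 4 then 0 else arr d2 w)" for w
    by (simp add: d3_def clean_loop)
  have d3: "flag d3 = flag d2" "crit d3 = crit d2" "count d3 = count d2"
    by (simp_all add: d3_def clean_loop)
  have CR: "C \<subseteq> R"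
  proof
    fix j assume j: "j \<in> C"
    then have "j \<in> {1..n}" "arr d2 j = 2" by (auto simp: C_def marked_def)
    then show "j \<in> R" using i by (metis DiffI numeral_eq_iff semiring_norm(88))
  qed
  have arrR: "arr d2 j = (if j \<in> C then 2 else 4)" if "j \<in> R" for j
  proof -
    have "j \<in> {1..n}" "arr d2 j \<in> {0, 2, 4}" "arr d2 j \<noteq> 0"
      using that R' i m0 by (auto simp: marked_def)
    then show ?thesis by (auto simp: C_def marked_def)
  qed
  have arrN: "arr d2 j = 3" if "j \<in> {1..n}" "j \<notin> R" for j using i that by blast
  show thesis
  proof
    have "r \<in> marked 2 d1" using r R' by (auto simp: d1_def add_eq marked_def)
    then show "r \<in> C" using sub by blast
    show "C \<subseteq> R" by (rule CR)
    show "\<not> adj i j" if "i \<in> C" "j \<in> C" for i j using i that by (simp add: C_def)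
    show "\<exists>j\<in>C. adj i j" if "i \<in> R - C" for i
    proof -
      have "i \<in> marked 4 d2" using that R' arrR[of i] by (auto simp: marked_def)
      then show ?thesis using inv by (auto simp: class_inv_def C_def)
    qed
    have arr: "arr (greedy_class u r d) = arr d3" by (simp add: g)
    have "arr d3 j = (if j \<in> R - C then 0 else 3)" if "j \<in> {1..n}" for j
    proof (cases "j \<in> R")
      case True
      show ?thesis using that True arrR[OF True] by (simp add: arr3)
    next
      case False
      then show ?thesis using that arrN[OF that False] CR by (auto simp: arr3)
    qed
    then show "marked 0 (greedy_class u r d) = R - C" "\<forall>i\<in>{1..n}. arr (greedy_class u r d) i \<in> {0, 3}"
      using R' by (auto simp: marked_def arr split: if_splits)
    show "count (greedy_class u r d) = count d" using i by (simp add: g d3)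
    show "crit (greedy_class u r d) = (if \<exists>j\<in>C. adj u j then crit d else 2)"
      using i by (simp add: g d3 C_def)
  qed
qed

lemma vertex_in: "i \<in> {1..n} \<Longrightarrow> vertex i \<in> verts G"
  using bij by (auto simp: bij_betw_def)

lemma vertex_image_Diff: "A \<subseteq> {1..n} \<Longrightarrow> B \<subseteq> {1..n} \<Longrightarrow> vertex ` (A - B) = vertex ` A - vertex ` B"
  using bij by (intro inj_on_image_set_diff[of _ "{1..n}"]) (auto simp: bij_betw_def)

text \<open>\<open>u\<close> carries the mark 3 to keep it out of all classes, so it has to be
  removed explicitly from the set of coloured vertices.\<close>

definition test_inv :: "nat \<Rightarrow> nat \<Rightarrow> mem \<Rightarrow> bool" where
  "test_inv u c d \<longleftrightarrow> (\<forall>i\<in>{1..n}. arr d i \<in> {0, 3}) \<and> arr d u = 3 \<and> count d = c \<and>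
     (\<exists>m. greedy_state G (vertex u) (vertex ` ({1..n} - {u} - marked 0 d)) m (crit d = 3))"

lemma test_inv_step:
  assumes inv: "test_inv u c d" and u: "u \<in> {1..n}" and r: "r \<in> {1..n}" "arr d r = 0"
  shows "test_inv u c (greedy_class u r d)" "arr (greedy_class u r d) r = 3"
    "marked 0 (greedy_class u r d) \<subseteq> marked 0 d"
proof -
  let ?R = "marked 0 d" and ?d = "greedy_class u r d"
  obtain m where m: "greedy_state G (vertex u) (vertex ` ({1..n} - {u} - ?R)) m (crit d = 3)"
    using inv test_inv_def by blast
  have A: "\<forall>i\<in>{1..n}. arr d i \<in> {0, 3}" and u3: "arr d u = 3" using inv by (auto simp: test_inv_def)
  have R: "?R \<subseteq> {1..n}" "u \<notin> ?R" using u3 by (auto simp: marked_def)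
  have rR: "r \<in> ?R" using r by (simp add: marked_def)
  obtain C where C: "r \<in> C" "C \<subseteq> ?R" "\<And>i j. i \<in> C \<Longrightarrow> j \<in> C \<Longrightarrow> \<not> adj i j"
    "\<And>i. i \<in> ?R - C \<Longrightarrow> \<exists>j\<in>C. adj i j" "marked 0 ?d = ?R - C"
    "\<forall>i\<in>{1..n}. arr ?d i \<in> {0, 3}" "count ?d = count d"
    "crit ?d = (if \<exists>j\<in>C. adj u j then crit d else 2)"
    using greedy_class[OF refl A rR, of u] by blast
  have all3: "arr ?d i = 3" if "i \<in> {1..n}" "i \<notin> ?R - C" for i
  proof -
    have "i \<notin> marked 0 ?d" using C(5) that(2) by blast
    then have "arr ?d i \<noteq> 0" using that(1) by (simp add: marked_def)
    then show ?thesis using bspec[OF C(6) that(1)] by simp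
  qed
  show "arr ?d r = 3" using all3[of r] r(1) C(1) by blast
  show "marked 0 ?d \<subseteq> ?R" using C(5) by blast
  have V: "verts G = vertex ` {1..n}" using bij by (auto simp: bij_betw_def)
  have sub: "C \<subseteq> {1..n}" using C(2) R by blast
  have mi: "maximal_indep G (vertex ` ?R) (vertex ` C)"
  proof (rule maximal_indepI)
    show "vertex ` C \<subseteq> vertex ` ?R" using C(2) by blast
    show "{x, y} \<notin> edges G" if xy: "x \<in> vertex ` C" "y \<in> vertex ` C" for x y
    proof -
      obtain i j where "i \<in> C" "j \<in> C" "x = vertex i" "y = vertex j" using xy by blast
      then show ?thesis using C(3)[of i j] adj_iff[of i j] sub by blast
    qed
    show "\<exists>y\<in>vertex ` C. {x, y} \<in> edges G" if x: "x \<in> vertex ` ?R - vertex ` C" for x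
    proof -
      obtain i where "i \<in> ?R - C" "x = vertex i" using x by blast
      moreover then obtain j where "j \<in> C" "adj i j" using C(4) by blast
      ultimately show ?thesis using adj_iff[of i j] sub R(1) by blast
    qed
  qed
  have VR: "vertex ` ?R = verts G - {vertex u} - vertex ` ({1..n} - {u} - ?R)"
  proof -
    have "?R = {1..n} - {u} - ({1..n} - {u} - ?R)" using R by blast
    then have "vertex ` ?R = vertex ` ({1..n} - {u} - ({1..n} - {u} - ?R))" by simp
    also have "\<dots> = vertex ` ({1..n} - {u}) - vertex ` ({1..n} - {u} - ?R)"
      by (rule vertex_image_Diff) auto
    also have "vertex ` ({1..n} - {u}) = verts G - {vertex u}"
      using vertex_image_Diff[of "{1..n}" "{u}"] u V by simp
    finally show ?thesis .
  qed
  have ne: "vertex ` ?R \<noteq> {}" using rR by blast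
  have ok: "(crit ?d = 3) \<longleftrightarrow> crit d = 3 \<and> (\<exists>v\<in>vertex ` C. {vertex u, v} \<in> edges G)"
  proof -
    have "adj u j \<longleftrightarrow> {vertex u, vertex j} \<in> edges G" if "j \<in> C" for j
      using adj_iff[OF u, of j] that sub by blast
    then show ?thesis unfolding C(8) by auto
  qed
  have "greedy_state G (vertex u) (vertex ` ({1..n} - {u} - ?R) \<union> vertex ` C) (Suc m) (crit ?d = 3)"
    by (rule greedy_state_step[OF cograph vertex_in[OF u] m VR ne mi ok])
  moreover have "{1..n} - {u} - marked 0 ?d = ({1..n} - {u} - ?R) \<union> C"
    using C(2,5) R sub by blast
  ultimately have "greedy_state G (vertex u) (vertex ` ({1..n} - {u} - marked 0 ?d)) (Suc m) (crit ?d = 3)"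
    by (simp add: image_Un)
  moreover have "arr ?d u = 3" using all3[of u] u R(2) by blast
  ultimately show "test_inv u c ?d"
    unfolding test_inv_def using C(6,7) inv by (auto simp: test_inv_def)
qed

lemma clear_loop:
  "for_all (\<lambda>v. put v 0) d = d\<lparr>arr := (\<lambda>w. if w \<in> {1..n} then 0 else arr d w)\<rparr>"
proof -
  let ?P = "\<lambda>i e. e = d\<lparr>arr := (\<lambda>w. if w \<in> {1..i} then 0 else arr d w)\<rparr>"
  have "?P n (for_all (\<lambda>v. put v 0) d)"
    unfolding for_all_def
  proof (rule fold_invariant_upto[where P = ?P])
    show "?P 0 d" by (rule mem.equality) (auto simp: fun_eq_iff)
    fix i e assume e: "?P i e"
    show "?P (Suc i) (put (Suc i) 0 e)"
      by (rule mem.equality) (use e in \<open>auto simp: put_def fun_eq_iff le_Suc_eq\<close>)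
  qed
  then show ?thesis .
qed

text \<open>Each class takes its first vertex out of the set marked 0, and no vertex returns to that
  set. After one pass it is empty, the coloured vertices are all but \<open>u\<close>, and
  \<open>greedy_state_final\<close> applies.\<close>

lemma count_test:
  assumes u: "u \<in> {1..n}"
  shows "count (test u d) = count d + (if critical G (vertex u) then 1 else 0)"
proof -
  define d1 where "d1 = put u 3 (for_all (\<lambda>v. put v 0) (d\<lparr>crit := 3\<rparr>))"
  let ?f = "\<lambda>r d. if arr d r = 0 then greedy_class u r d else d"
  define d2 where "d2 = for_all ?f d1"
  have arr1: "arr d1 i = (if i = u then 3 else if i \<in> {1..n} then 0 else arr d i)" for i
    by (simp add: d1_def clear_loop put_def)
  have c1: "crit d1 = 3" "count d1 = count d" by (simp_all add: d1_def clear_loop put_def)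
  have e: "{1..n} - {u} - marked 0 d1 = {}" by (auto simp: marked_def arr1)
  have "greedy_state G (vertex u) (vertex ` ({1..n} - {u} - marked 0 d1)) 0 (crit d1 = 3)"
    unfolding e image_empty c1(1) using greedy_state_init by simp
  moreover have "\<forall>i\<in>{1..n}. arr d1 i \<in> {0, 3}" "arr d1 u = 3" by (simp_all add: arr1)
  ultimately have "test_inv u (count d) d1" unfolding test_inv_def using c1(2) by blast
  let ?P = "\<lambda>i e. test_inv u (count d) e \<and> (\<forall>j\<in>{1..i}. arr e j \<noteq> 0)"
  have "?P n d2"
    unfolding d2_def for_all_def
  proof (rule fold_invariant_upto[where P = ?P])
    show "?P 0 d1" using \<open>test_inv u (count d) d1\<close> by simp
    fix i e assume i: "i < n" and P: "?P i e"
    show "?P (Suc i) (?f (Suc i) e)"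
    proof (cases "arr e (Suc i) = 0")
      case True
      have s: "test_inv u (count d) (greedy_class u (Suc i) e)" "arr (greedy_class u (Suc i) e) (Suc i) = 3"
        "marked 0 (greedy_class u (Suc i) e) \<subseteq> marked 0 e"
        using test_inv_step[OF _ u _ True] P i by auto
      have "arr (greedy_class u (Suc i) e) j \<noteq> 0" if j: "j \<in> {1..Suc i}" for j
      proof (cases "j = Suc i")
        case False
        then have "j \<in> {1..i}" using j by simp
        then have "j \<notin> marked 0 e" using P by (simp add: marked_def)
        then have "j \<notin> marked 0 (greedy_class u (Suc i) e)" using s(3) by blast
        then show ?thesis using j i by (simp add: marked_def)
      qed (use s(2) in simp)
      then show ?thesis using True s(1) by simp
    next
      case False
      then show ?thesis using P by (auto simp: le_Suc_eq)
    qed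
  qed
  then have inv: "test_inv u (count d) d2" and "marked 0 d2 = {}" by (auto simp: marked_def)
  then obtain m where "greedy_state G (vertex u) (vertex ` ({1..n} - {u})) m (crit d2 = 3)"
    unfolding test_inv_def by auto
  moreover have "vertex ` ({1..n} - {u}) = verts G - {vertex u}"
    using vertex_image_Diff[of "{1..n}" "{u}"] u bij by (simp add: bij_betw_def)
  ultimately have "critical G (vertex u) \<longleftrightarrow> crit d2 = 3"
    using greedy_state_final[OF vertex_in[OF u]] by simp
  moreover have "count d2 = count d" using inv by (simp add: test_inv_def)
  moreover have "test u d = (if crit d2 = 3 then d2\<lparr>count := Suc (count d2)\<rparr> else d2)"
    by (simp add: test_def d1_def d2_def Let_def)
  ultimately show ?thesis by simp
qed

lemma count_all_tests:
  "count (for_all test d) = count d + card {u \<in> verts G. critical G u}"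
proof -
  let ?P = "\<lambda>i (e :: mem). count e = count d + card {j \<in> {1..i}. critical G (vertex j)}"
  have "?P n (for_all test d)"
    unfolding for_all_def
  proof (rule fold_invariant_upto[where P = ?P])
    show "?P 0 d" by simp
    fix i e assume i: "i < n" and P: "?P i e"
    have "{j \<in> {1..Suc i}. critical G (vertex j)} = (if critical G (vertex (Suc i))
        then insert (Suc i) {j \<in> {1..i}. critical G (vertex j)} else {j \<in> {1..i}. critical G (vertex j)})"
      by (auto simp: le_Suc_eq)
    then show "?P (Suc i) (test (Suc i) e)" using P count_test[of "Suc i" e] i by simp
  qed
  moreover have "card {j \<in> {1..n}. critical G (vertex j)} = card {u \<in> verts G. critical G u}"
  proof (rule bij_betw_same_card[of vertex])
    show "bij_betw vertex {j \<in> {1..n}. critical G (vertex j)} {u \<in> verts G. critical G u}"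
    proof (rule bij_betw_imageI)
      show "inj_on vertex {j \<in> {1..n}. critical G (vertex j)}"
        using bij by (auto simp: bij_betw_def intro: inj_on_subset)
      have V: "verts G = vertex ` {1..n}" using bij by (simp add: bij_betw_def)
      show "vertex ` {j \<in> {1..n}. critical G (vertex j)} = {u \<in> verts G. critical G u}"
        unfolding V by auto
    qed
  qed
  ultimately show ?thesis by simp
qed

end

section \<open>Reading the adjacency matrix and assembling the result\<close>

lemma adj_matrix_nth:
  assumes "i < length vs" "j < length vs"
  shows "adj_matrix vs G ! (i * length vs + j) \<longleftrightarrow> {vs ! i, vs ! j} \<in> edges G"
proof -
  \<comment> \<open>The list of rows is separated from the list of columns, as an induction on
    \<open>vs\<close> itself would shorten the rows too.\<close>
  have "concat (map (\<lambda>u. map (\<lambda>v. {u, v} \<in> edges G) vs) us) ! (i * length vs + j) \<longleftrightarrow>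
      {us ! i, vs ! j} \<in> edges G" if "i < length us" for us i
    using that
  proof (induction us arbitrary: i)
    case (Cons u us)
    then show ?case using assms(2) by (cases i) (simp_all add: nth_append)
  qed simp
  then show ?thesis unfolding adj_matrix_def using assms(1) by blast
qed

lemma length_adj_matrix: "length (adj_matrix vs G) = length vs * length vs"
proof -
  have "length (concat (map (\<lambda>u. map (\<lambda>v. {u, v} \<in> edges G) vs) us)) = length us * length vs" for us
    by (induction us) simp_all
  then show ?thesis by (simp add: adj_matrix_def)
qed

text \<open>Supplies the assumption \<open>1 \<le> n\<close> of the locale
  \<open>adjacency\<close>.\<close>

lemma cograph_nonempty: "cograph G \<Longrightarrow> verts G \<noteq> {}"
  by (induction rule: cograph.induct) (simp_all add: disjoint_union_def graph_join_def)

lemma stability_prog_correct: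
  assumes G: "cograph G" and vs: "distinct vs" "set vs = verts G"
  defines "x \<equiv> adj_matrix vs G"
  shows "read_tape (exec (length x) stability_prog (init_store x) 11) \<in> {1} \<longleftrightarrow> chi_stable G"
proof -
  let ?n = "length vs" and ?inp = "fst (input_tape x)"
  \<comment> \<open>Indices on the tapes start from 1 because cell 0 holds the start marker; list
    positions start from 0.\<close>
  define vertex where "vertex i = vs ! (i - 1)" for i
  have n1: "1 \<le> ?n" using cograph_nonempty[OF G] vs(2) by (cases vs) auto
  have N: "?n * ?n = length x" by (simp add: x_def length_adj_matrix)
  interpret adjacency ?inp ?n "length x" by unfold_locales (rule n1, rule N)
  have "bij_betw vertex {1..?n} (verts G)"
  proof -
    have "bij_betw (\<lambda>i. i - 1) {1..?n} {..<?n}"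
      by (rule bij_betw_byWitness[where f' = Suc]) auto
    moreover have "bij_betw ((!) vs) {..<?n} (verts G)" using bij_betw_nth[OF vs(1) refl] vs(2) by simp
    ultimately have "bij_betw ((!) vs \<circ> (\<lambda>i. i - 1)) {1..?n} (verts G)" by (rule bij_betw_trans)
    then show ?thesis unfolding comp_def vertex_def[abs_def] .
  qed
  moreover have "adj i j \<longleftrightarrow> {vertex i, vertex j} \<in> edges G" if "i \<in> {1..?n}" "j \<in> {1..?n}" for i j
  proof -
    have "(i - 1) * ?n + j \<le> (?n - 1) * ?n + ?n" using that by (intro add_mono mult_le_mono) auto
    also have "\<dots> = length x" using n1 N by (cases ?n) auto
    finally have "adj i j \<longleftrightarrow> x ! ((i - 1) * ?n + (j - 1))"
      using that unfolding adj_def by (simp add: input_tape_def bit_sym_def)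
    moreover have "i - 1 < ?n" "j - 1 < ?n" using that by auto
    ultimately show ?thesis using adj_matrix_nth[of "i - 1" vs "j - 1" G] unfolding x_def vertex_def by blast
  qed
  ultimately interpret cograph_input ?inp ?n "length x" G vertex
    using G by unfold_locales auto
  let ?d = "for_all test init_mem" and ?c = "card {u \<in> verts G. critical G u}"
  have "count ?d = ?c" using count_all_tests[of init_mem] by (simp add: init_mem_def)
  moreover have "exec (length x) stability_prog (init_store x) =
      exec (length x) (PMove 11 Move_Left) (mem_store ?inp ?n (\<lambda>_. 0) ?d)"
    unfolding stability_prog_def exec.simps(3) exec_index_setup[OF n1 N] exec_all_tests by (rule refl)
  ultimately have "exec (length x) stability_prog (init_store x) 11 = (fst empty_tape, ?c - 1)"
    by (simp add: mem_store_def)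
  then show ?thesis
    using chi_stable_iff_card_critical[OF G] by (auto simp: read_tape_def empty_tape_def)
qed

text \<open>Tapes 0 to 11 are used, and the largest symbol written is the mark 4.\<close>

lemma prog_ok_stability_prog: "prog_ok 12 5 stability_prog"
  by (simp add: stability_prog_def index_setup_def setup_step_def test_prog_def class_prog_def
      add_prog_def append_mark_def put_mark_def if_mark_def if_adj_def goto_entry_def goto_def
      loop_def rewind_def skip_def)

theorem theorem19: "in_P_on {G. cograph G} chi_Stability"
proof -
  obtain M where M: "wf_tm M" "poly_time M"
    "\<And>x. read_tape (exec (length x) stability_prog (init_store x) 11) \<in> {1} \<Longrightarrow> accepts M x"
    "\<And>x. read_tape (exec (length x) stability_prog (init_store x) 11) \<notin> {1} \<Longrightarrow> rejects M x"
    using ex_poly_time_tm[OF prog_ok_stability_prog, of 11 "{1}"] by auto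
  have "G \<in> chi_Stability \<longleftrightarrow> chi_stable G" if "cograph G" for G :: "nat graph"
    using cograph_simple_graph[OF that] by (simp add: chi_Stability_def)
  then show ?thesis
    unfolding in_P_on_def using M stability_prog_correct by blast
qed

end
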